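(* Let $(a_n)_{n\ge0}$ be the sequence, listed in increasing order, of the non-negative integers $m$ such that $240m+1$ is a perfect square. Then $$\sum_{n=0}^\infty(-1)^{\lfloor (n+2)/4\rfloor}q^{a_n}=\frac{(q,q^7,q^8;q^8)_\infty\,(q^6,q^{10};q^{16})_\infty}{(q,q^4;q^5)_\infty}.$$
   Context: Here $q$ is a complex number with $|q|<1$ (equivalently, the identity may be read as an identity of formal power series in $q$). For a complex number $a$, $(a;q)_\infty:=\prod_{i=0}^\infty(1-aq^i)$, and $(a_1,a_2,\dots,a_m;q)_\infty:=\prod_{j=1}^m(a_j;q)_\infty$. $\lfloor x\rfloor$ is the floor function. *)

theory Defs
  imports "HOL-Analysis.Analysis" "HOL-Computational_Algebra.Nth_Powers"
begin

definition qpoch_inf :: "complex \<Rightarrow> complex \<Rightarrow> complex" where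
  "qpoch_inf a q = (\<Prod>i. 1 - a * q ^ i)"

definition qpochs_inf :: "complex list \<Rightarrow> complex \<Rightarrow> complex" where
  "qpochs_inf as q = (\<Prod>a\<leftarrow>as. qpoch_inf a q)"

definition sq_seq :: "nat \<Rightarrow> nat" where
  "sq_seq = enumerate {m. is_square (240 * m + 1)}"

lemma qpoch_inf_convergent:
  fixes a q :: complex
  assumes "norm q < 1"
  shows "convergent_prod (\<lambda>i. 1 - a * q ^ i)"
proof -
  have "summable (\<lambda>i. norm a * norm q ^ i)"
    using assms by (intro summable_mult summable_geometric) simp
  hence "summable (\<lambda>i. norm ((1 - a * q ^ i) - 1))"
    by (simp add: norm_mult norm_power)
  thus ?thesis
    by (intro abs_convergent_prod_imp_convergent_prod summable_imp_abs_convergent_prod)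
qed

lemma infinite_sq_indices: "infinite {m::nat. is_square (240 * m + 1)}"
proof -
  have "inj (\<lambda>k::nat. 60 * k\<^sup>2 + k)"
  proof (rule strict_mono_imp_inj_on, rule strict_monoI)
    fix x y :: nat assume "x < y"
    thus "60 * x\<^sup>2 + x < 60 * y\<^sup>2 + y"
      by (intro add_le_less_mono mult_left_mono power_mono) auto
  qed
  hence "infinite (range (\<lambda>k::nat. 60 * k\<^sup>2 + k))"
    by (rule range_inj_infinite)
  moreover have "range (\<lambda>k::nat. 60 * k\<^sup>2 + k) \<subseteq> {m. is_square (240 * m + 1)}"
  proof safe
    fix k :: nat
    have "240 * (60 * k\<^sup>2 + k) + 1 = (120 * k + 1)\<^sup>2"
      by (simp add: power2_eq_square algebra_simps)
    thus "is_square (240 * (60 * k\<^sup>2 + k) + 1)"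
      by (simp only: is_nth_power_nth_power)
  qed
  ultimately show ?thesis
    using finite_subset by blast
qed

lemma strict_mono_sq_seq: "strict_mono sq_seq"
  unfolding sq_seq_def by (rule strict_mono_enumerate[OF infinite_sq_indices])

lemma range_sq_seq: "range sq_seq = {m. is_square (240 * m + 1)}"
  unfolding sq_seq_def by (rule range_enumerate[OF infinite_sq_indices])

end

theory Submission
  imports Defs "HOL-Library.Nat_Bijection"
begin

text \<open>
  Write \<open>q = x\<^sup>2\<close>. Two instances of the quintuple product identity in base \<open>x\<^sup>2\<^sup>0\<close>,
  at \<open>z = x\<^sup>3\<close> and \<open>z = x\<^sup>7\<close>, share the factor \<open>(x\<^sup>3, x\<^sup>7, x\<^sup>1\<^sup>3, x\<^sup>1\<^sup>7; x\<^sup>2\<^sup>0)\<close>. The first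
  minus \<open>x\<close> times the second leaves the 2-dissection of the triple product
  \<open>(x, x\<^sup>4, x\<^sup>5; x\<^sup>5)\<close>, so that this difference equals \<open>(x; x) / (x\<^sup>2, x\<^sup>8; x\<^sup>1\<^sup>0)\<close>. Now take the
  even part in \<open>x\<close>. The denominator \<open>(q, q\<^sup>4; q\<^sup>5)\<close> is already even; by the pentagonal number
  theorem and the quintuple product identity in base \<open>q\<^sup>8\<close> at \<open>z = q\<close>, the even part of
  \<open>(x; x)\<close> is the numerator of the claim. On the series side the even part consists
  of the powers \<open>q\<^sup>m\<close> with \<open>240 * m + 1 = (120 * j + c)\<^sup>2\<close> and \<open>c\<close> one of \<open>1, 31, 41, 49\<close>, with
  positive sign for the first two and negative sign for the last two.
\<close>

section \<open>The Jacobi triple product\<close>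

definition qfact :: "complex \<Rightarrow> nat \<Rightarrow> complex" where
  "qfact q n = (\<Prod>i<n. 1 - q ^ Suc i)"

text \<open>The Gaussian binomial coefficient. The value 0 for \<open>k > n\<close> makes the Pascal
  rule below valid at the boundary \<open>k = n\<close> as well.\<close>

definition qbinom :: "complex \<Rightarrow> nat \<Rightarrow> nat \<Rightarrow> complex" where
  "qbinom q n k = (if k \<le> n then qfact q n / (qfact q k * qfact q (n - k)) else 0)"

lemma one_minus_mult_power_nonzero:
  fixes a q :: complex
  assumes "norm q < 1" "norm a < 1"
  shows "1 - a * q ^ i \<noteq> 0"
proof
  assume "1 - a * q ^ i = 0"
  hence "norm a * norm q ^ i = 1"
    by (metis eq_iff_diff_eq_0 norm_mult norm_one norm_power)
  moreover have "norm a * norm q ^ i \<le> norm a * 1"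
    using assms by (intro mult_left_mono power_le_one) auto
  ultimately show False using assms by simp
qed

lemma qpoch_inf_nonzero:
  assumes "norm q < 1" "norm a < 1"
  shows "qpoch_inf a q \<noteq> 0"
  unfolding qpoch_inf_def
  using qpoch_inf_convergent[OF assms(1)] one_minus_mult_power_nonzero[OF assms]
  by (rule prodinf_nonzero)

lemma qpoch_inf_LIMSEQ:
  assumes "norm q < 1"
  shows "(\<lambda>n. \<Prod>i<n. 1 - a * q ^ i) \<longlonglongrightarrow> qpoch_inf a q"
proof -
  have "(\<lambda>n. \<Prod>i\<le>n. 1 - a * q ^ i) \<longlonglongrightarrow> qpoch_inf a q"
    unfolding qpoch_inf_def by (intro convergent_prod_LIMSEQ qpoch_inf_convergent assms)
  hence "(\<lambda>n. \<Prod>i<Suc n. 1 - a * q ^ i) \<longlonglongrightarrow> qpoch_inf a q"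
    by (simp only: lessThan_Suc_atMost)
  thus ?thesis by (rule LIMSEQ_imp_Suc)
qed

lemma qfact_nonzero:
  assumes "norm q < 1"
  shows "qfact q n \<noteq> 0"
  using one_minus_mult_power_nonzero[OF assms assms] by (simp add: qfact_def)

lemma qfact_Suc: "qfact q (Suc n) = qfact q n * (1 - q ^ Suc n)"
  by (simp add: qfact_def)

lemma qfact_LIMSEQ:
  assumes "norm q < 1"
  shows "qfact q \<longlonglongrightarrow> qpoch_inf q q"
  using qpoch_inf_LIMSEQ[OF assms, of q] by (simp add: qfact_def [abs_def])

lemma qbinom_0 [simp]: "norm q < 1 \<Longrightarrow> qbinom q n 0 = 1"
  using qfact_nonzero[of q n] by (simp add: qbinom_def qfact_def)

text \<open>One of the two q-Pascal rules. With \<open>n = k + m + 1\<close> it comes from splitting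
  the new top factor as \<open>1 - q ^ (n + 1) = (1 - q ^ (m + 1)) + q ^ (m + 1) * (1 - q ^ (k +
  1))\<close>.\<close>

lemma qbinom_Suc_Suc:
  assumes "norm q < 1" "k \<le> n"
  shows "qbinom q (Suc n) (Suc k) = qbinom q n (Suc k) + q ^ (n - k) * qbinom q n k"
proof (cases "k = n")
  case True
  thus ?thesis using qfact_nonzero[OF assms(1)] by (simp add: qbinom_def)
next
  case False
  then obtain m where n: "n = Suc (k + m)"
    using assms(2) by (metis le_neq_implies_less less_imp_Suc_add)
  have nz: "qfact q i \<noteq> 0" "1 - q ^ Suc i \<noteq> 0" for i
    using qfact_nonzero[OF assms(1)] one_minus_mult_power_nonzero[OF assms(1) assms(1)] by auto
  have 1: "Suc n - Suc k = Suc m" "n - Suc k = m" "n - k = Suc m" using n by auto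
  define A B where "A = 1 - q ^ Suc k" and "B = 1 - q ^ Suc m"
  have "1 - q ^ Suc n = B + q ^ Suc m * A"
    by (simp add: n A_def B_def algebra_simps power_add)
  hence 2: "qfact q (Suc n) = qfact q n * (B + q ^ Suc m * A)" by (simp only: qfact_Suc)
  have 3: "qfact q (Suc k) = qfact q k * A" "qfact q (Suc m) = qfact q m * B"
    by (simp_all only: qfact_Suc A_def B_def)
  have nz': "A \<noteq> 0" "B \<noteq> 0" "qfact q k \<noteq> 0" "qfact q m \<noteq> 0" using nz A_def B_def by auto
  have le: "Suc k \<le> Suc n" "Suc k \<le> n" "k \<le> n" using n by auto
  show ?thesis
    unfolding qbinom_def if_P[OF le(1)] if_P[OF le(2)] if_P[OF le(3)] 1 2 3
    using nz' by (simp add: divide_simps) (simp add: algebra_simps)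
qed

text \<open>Induction on \<open>n\<close>: the weight satisfies
  \<open>t (k + 1) = t k * y * q ^ k\<close>, so the factor \<open>q ^ (n - k)\<close> of the Pascal
  rule combines to \<open>y * q ^ n\<close>, the second summand of the new factor
  \<open>1 + y * q ^ n\<close>.\<close>

lemma q_binomial_theorem:
  assumes "norm q < 1"
  shows "(\<Prod>i<n. 1 + y * q ^ i) = (\<Sum>k\<le>n. q ^ (k * (k - 1) div 2) * y ^ k * qbinom q n k)"
proof (induction n)
  case 0
  show ?case using assms by simp
next
  case (Suc n)
  define t where "t k = q ^ (k * (k - 1) div 2) * y ^ k" for k
  have tri: "Suc k * (Suc k - 1) div 2 = k * (k - 1) div 2 + k" for k :: nat
    by (cases k) (simp_all add: algebra_simps)
  have t: "t (Suc k) = t k * y * q ^ k" for k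
    unfolding t_def tri by (simp add: power_add)
  have step: "t (Suc k) * qbinom q (Suc n) (Suc k)
      = t (Suc k) * qbinom q n (Suc k) + y * q ^ n * (t k * qbinom q n k)" if "k \<le> n" for k
  proof -
    have "q ^ n = q ^ k * q ^ (n - k)"
      using that by (simp flip: power_add)
    thus ?thesis
      by (simp add: qbinom_Suc_Suc[OF assms that] t algebra_simps)
  qed
  have "(\<Sum>k\<le>Suc n. t k * qbinom q (Suc n) k)
      = t 0 + (\<Sum>k\<le>n. t (Suc k) * qbinom q (Suc n) (Suc k))"
    using assms by (simp only: sum.atMost_Suc_shift qbinom_0 mult_1_right)
  also have "\<dots> = t 0 + (\<Sum>k\<le>n. t (Suc k) * qbinom q n (Suc k))
        + y * q ^ n * (\<Sum>k\<le>n. t k * qbinom q n k)"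
    by (simp add: step sum.distrib sum_distrib_left)
  also have "t 0 + (\<Sum>k\<le>n. t (Suc k) * qbinom q n (Suc k)) = (\<Sum>k\<le>Suc n. t k * qbinom q n k)"
    using assms by (simp only: sum.atMost_Suc_shift qbinom_0 mult_1_right)
  also have "\<dots> = (\<Sum>k\<le>n. t k * qbinom q n k)"
    by (simp add: qbinom_def)
  finally show ?case
    using Suc by (simp add: t_def algebra_simps)
qed

section \<open>Theta series and the finite triple product\<close>

definition theta_term :: "complex \<Rightarrow> complex \<Rightarrow> int \<Rightarrow> complex" where
  "theta_term q w j = q powi (j * (j - 1) div 2) * w powi j"

lemma triangle_double: "2 * (j * (j - 1) div 2) = j * (j - 1)" for j :: int
  by simp

lemma pentagonal_double: "2 * (k * (3 * k - 1) div 2) = k * (3 * k - 1)" for k :: int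
  by simp

lemma int_triangle: "int (n * (n - 1) div 2) = int n * (int n - 1) div 2"
  by (cases n) (simp_all add: zdiv_int algebra_simps)

text \<open>The q-binomial theorem with \<open>2 * n\<close> factors at
  \<open>y = w * q powi (- n)\<close>. The upper half of the product is the
  \<open>w\<close>-product, the lower half read backwards is the \<open>q / w\<close>-product up to
  a monomial, and the summation index is recentred at \<open>n\<close>.\<close>

lemma finite_triple_product:
  assumes "norm q < 1" "q \<noteq> 0" "w \<noteq> 0"
  shows "(\<Prod>i<n. 1 + w * q ^ i) * (\<Prod>i<n. 1 + q / w * q ^ i)
           = (\<Sum>j\<in>{-int n..int n}. theta_term q w j * qbinom q (2 * n) (nat (int n + j)))"
proof -
  define y where "y = w * q powi (- int n)"
  \<comment> \<open>Factor number \<open>n - 1 - i\<close> is \<open>w / q ^ (i + 1)\<close> times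
    \<open>1 + q / w * q ^ i\<close>; the extracted monomials multiply to \<open>w ^ n\<close> over
    \<open>q\<close> to the power \<open>n * (n + 1) / 2\<close>.\<close>
  have P1: "(\<Prod>i<n. 1 + y * q ^ i) * (q powi (int n * (int n + 1) div 2)) 
      = w ^ n * (\<Prod>i<n. 1 + q / w * q ^ i)"
  proof -
    have "(\<Prod>i<n. 1 + y * q ^ i) = (\<Prod>i<n. 1 + y * q ^ (n - Suc i))"
      by (rule prod.nat_diff_reindex [symmetric])
    also have "\<dots> = (\<Prod>i<n. w / q ^ Suc i * (1 + q / w * q ^ i))"
    proof (intro prod.cong refl)
      fix i assume "i \<in> {..<n}"
      hence "q ^ n = q ^ (n - Suc i) * q ^ Suc i" by (subst power_add [symmetric]) simp
      hence "y * q ^ (n - Suc i) = w / q ^ Suc i"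
        using assms by (simp add: y_def power_int_minus divide_simps del: power_Suc)
      thus "1 + y * q ^ (n - Suc i) = w / q ^ Suc i * (1 + q / w * q ^ i)"
        using assms by (simp add: divide_simps) (simp add: algebra_simps)
    qed
    also have "\<dots> = w ^ n / (\<Prod>i<n. q ^ Suc i) * (\<Prod>i<n. 1 + q / w * q ^ i)"
      by (simp add: prod.distrib prod_dividef del: power_Suc)
    also have "(\<Prod>i<n. q ^ Suc i) = q powi (int n * (int n + 1) div 2)"
    proof (induction n)
      case (Suc n)
      have "int (Suc n) * (int (Suc n) + 1) div 2 = int n * (int n + 1) div 2 + int (Suc n)"
        using triangle_double[of "int n + 1"] triangle_double[of "int n + 2"]
        by (simp add: algebra_simps)
      thus ?case using Suc assms by (simp add: power_int_add del: of_nat_Suc power_Suc)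
    qed simp
    finally show ?thesis using assms by (simp del: power_Suc)
  qed
  have P2: "(\<Prod>i<n. 1 + y * q ^ (n + i)) = (\<Prod>i<n. 1 + w * q ^ i)"
    using assms by (intro prod.cong refl) (simp add: y_def power_int_minus power_add)
  have "(\<Prod>i<n+m. 1 + y * q ^ i) = (\<Prod>i<n. 1 + y * q ^ i) * (\<Prod>i<m. 1 + y * q ^ (n + i))" for m
    by (induction m) (simp_all add: mult.assoc)
  from this[of n] have "w ^ n * ((\<Prod>i<n. 1 + w * q ^ i) * (\<Prod>i<n. 1 + q / w * q ^ i))
     = (\<Prod>i<2*n. 1 + y * q ^ i) * q powi (int n * (int n + 1) div 2)"
    using P1 P2 by (simp add: mult_2)
  also have "\<dots> = (\<Sum>k\<le>2*n. q ^ (k * (k - 1) div 2) * y ^ k * q powi (int n * (int n + 1) div 2)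
                    * qbinom q (2*n) k)"
    unfolding q_binomial_theorem[OF assms(1)] sum_distrib_right by (simp add: mult_ac)
  also have "\<dots> = (\<Sum>j\<in>{-int n..int n}. w ^ n * (theta_term q w j * qbinom q (2 * n) (nat (int n + j))))"
  proof (rule sum.reindex_bij_witness[of _ "\<lambda>j. nat (int n + j)" "\<lambda>k. int k - int n"])
    fix k assume "k \<in> {..2*n}"
    define j where "j = int k - int n"
    have k: "int k = int n + j" by (simp add: j_def)
    \<comment> \<open>All powers of \<open>q\<close> collect into a single triangular number in
      \<open>j = k - n\<close>. Doubling every triangular number removes the division.\<close>
    have exp: "int k * (int k - 1) div 2 + int n * (int n + 1) div 2 - int n * int k = j * (j - 1) div 2"
      using triangle_double[of "int k"] triangle_double[of "int n + 1"] triangle_double[of j]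
      unfolding k by (simp add: algebra_simps)
    have "q ^ (k * (k - 1) div 2) * y ^ k * q powi (int n * (int n + 1) div 2)
       = w ^ k * (q powi (int k * (int k - 1) div 2) * q powi (- (int n * int k)) * q powi (int n * (int n + 1) div 2))"
      by (simp add: y_def power_mult_distrib power_int_power' flip: int_triangle)
    also have "q powi (int k * (int k - 1) div 2) * q powi (- (int n * int k)) * q powi (int n * (int n + 1) div 2)
      = q powi (j * (j - 1) div 2)"
      unfolding exp [symmetric] using assms by (simp add: power_int_add power_int_diff power_int_minus field_simps)
    also have "w ^ k = w ^ n * w powi j"
      using assms k by (metis power_int_add power_int_of_nat)
    finally show "w ^ n * (theta_term q w (int k - int n) * qbinom q (2 * n) (nat (int n + (int k - int n)))) =
         q ^ (k * (k - 1) div 2) * y ^ k * q powi (int n * (int n + 1) div 2) * qbinom q (2 * n) k"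
      by (simp add: theta_term_def j_def)
  qed auto
  finally show ?thesis
    using assms by (simp flip: sum_distrib_left)
qed

section \<open>Absolute convergence and the limit of the finite triple product\<close>

lemma summable_triangle_power:
  fixes r y :: real
  assumes "0 \<le> r" "r < 1" "0 \<le> y"
  shows "summable (\<lambda>n. r ^ (n * (n - 1) div 2) * y ^ n)"
proof -
  define f where "f n = r ^ (n * (n - 1) div 2) * y ^ n" for n
  \<comment> \<open>\<open>r ^ n * y\<close> is the ratio of consecutive terms. It tends to 0
    however large \<open>y\<close> is, so the ratio test applies from some \<open>N\<close>
    on.\<close>
  have "(\<lambda>n. r ^ n * y) \<longlonglongrightarrow> 0"
    using tendsto_mult_left_zero[OF LIMSEQ_realpow_zero[OF assms(1,2)]] .
  hence "eventually (\<lambda>n. r ^ n * y < 1 / 2) sequentially"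
    by (rule order_tendstoD) simp
  then obtain N where N: "\<And>n. n \<ge> N \<Longrightarrow> r ^ n * y < 1 / 2"
    by (auto simp: eventually_at_top_linorder)
  have tri: "Suc n * (Suc n - 1) div 2 = n * (n - 1) div 2 + n" for n :: nat
    by (cases n) (simp_all add: algebra_simps)
  have "f (Suc n) = (r ^ n * y) * f n" for n
    unfolding f_def tri by (simp add: power_add)
  moreover have "f n \<ge> 0" for n using assms by (simp add: f_def)
  ultimately have "norm (f (Suc n)) \<le> 1 / 2 * norm (f n)" if "n \<ge> N" for n
    using mult_right_mono[OF less_imp_le[OF N[OF that]], of "f n"] assms by (simp add: abs_mult)
  hence "summable f"
    by (intro summable_ratio_test[of "1 / 2" N]) auto
  thus ?thesis by (simp add: f_def [abs_def])
qed

text \<open>The terms at \<open>j = n\<close> and at \<open>j = - n\<close> are one-sided triangular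
  series with \<open>y = norm w\<close> and \<open>y = norm (q / w)\<close>. The two index ranges
  share 0, which is harmless for summability.\<close>

lemma norm_theta_term_summable:
  assumes "norm q < 1" "q \<noteq> 0" "w \<noteq> 0"
  shows "(\<lambda>j. norm (theta_term q w j)) summable_on UNIV"
proof -
  have *: "(\<lambda>n. norm q ^ (n * (n - 1) div 2) * y ^ n) summable_on UNIV" if "y \<ge> 0" for y
    using summable_triangle_power[of "norm q" y] that assms
    by (intro norm_summable_imp_summable_on) (simp_all add: norm_mult norm_power)
  note tri = int_triangle [symmetric]
  have tri': "- int n * (- int n - 1) div 2 = int (n * (n - 1) div 2) + int n" for n
  proof -
    have "2 * (- int n * (- int n - 1) div 2) = 2 * (int n * (int n - 1) div 2) + 2 * int n"
      unfolding triangle_double by (simp add: algebra_simps)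
    thus ?thesis unfolding tri by linarith
  qed
  have "(\<lambda>n. norm (theta_term q w (int n))) summable_on UNIV"
    using *[of "norm w"] unfolding theta_term_def tri
    by (simp add: norm_mult norm_power)
  hence 1: "(\<lambda>j. norm (theta_term q w j)) summable_on range int"
    by (subst summable_on_reindex) (auto simp: o_def)
  have "norm (theta_term q w (- int n)) = norm q ^ (n * (n - 1) div 2) * norm (q / w) ^ n" for n
    unfolding theta_term_def tri' using assms
    by (simp add: norm_mult norm_power norm_inverse norm_divide power_int_add power_int_minus power_divide)
       (simp add: divide_inverse)
  hence "(\<lambda>n. norm (theta_term q w (- int n))) summable_on UNIV"
    using *[of "norm (q / w)"] by simp
  hence 2: "(\<lambda>j. norm (theta_term q w j)) summable_on range (\<lambda>n. - int n)"
    by (subst summable_on_reindex) (auto simp: o_def inj_def)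
  have "UNIV = range int \<union> range (\<lambda>n. - int n)"
    by (auto simp: image_iff) (metis int_cases2)
  thus ?thesis using summable_on_union[OF 1 2] by simp
qed

text \<open>The sequence \<open>qfact q\<close> converges to a nonzero limit, so it and its inverse
  are bounded. The uniform bound provides the dominating series in the limit of the triple
  product.\<close>

lemma qbinom_bounded:
  assumes "norm q < 1"
  obtains M where "\<And>n k. norm (qbinom q n k) \<le> M"
proof -
  have lim: "qfact q \<longlonglongrightarrow> qpoch_inf q q" by (rule qfact_LIMSEQ[OF assms])
  have "Bseq (qfact q)" using lim by (auto intro: convergent_imp_Bseq convergentI)
  then obtain A where A: "A > 0" "\<And>n. norm (qfact q n) \<le> A" by (auto simp: Bseq_def)
  have "(\<lambda>n. inverse (qfact q n)) \<longlonglongrightarrow> inverse (qpoch_inf q q)"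
    by (intro tendsto_inverse lim qpoch_inf_nonzero assms)
  hence "Bseq (\<lambda>n. inverse (qfact q n))" by (auto intro: convergent_imp_Bseq convergentI)
  then obtain B where B: "B > 0" "\<And>n. norm (inverse (qfact q n)) \<le> B" by (auto simp: Bseq_def)
  have "norm (qbinom q n k) \<le> A * (B * B)" for n k
  proof (cases "k \<le> n")
    case True
    hence "qbinom q n k = qfact q n * (inverse (qfact q k) * inverse (qfact q (n - k)))"
      by (simp add: qbinom_def divide_inverse)
    also have "norm \<dots> \<le> A * (B * B)"
      unfolding norm_mult using A B by (intro mult_mono) auto
    finally show ?thesis .
  qed (use A B in \<open>auto simp: qbinom_def\<close>)
  thus ?thesis by (rule that)
qed

text \<open>For fixed \<open>j\<close> all three q-factorials in the quotient tend to the same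
  limit, and one copy cancels.\<close>

lemma qbinom_central_LIMSEQ:
  assumes "norm q < 1"
  shows "(\<lambda>n. qbinom q (2 * n) (nat (int n + j))) \<longlonglongrightarrow> 1 / qpoch_inf q q"
proof -
  have lim: "qfact q \<longlonglongrightarrow> qpoch_inf q q" by (rule qfact_LIMSEQ[OF assms])
  have nz: "qpoch_inf q q \<noteq> 0" by (rule qpoch_inf_nonzero[OF assms assms])
  have *: "(\<lambda>n. qfact q (nat (int n + i))) \<longlonglongrightarrow> qpoch_inf q q" for i
  proof (rule filterlim_compose[OF lim])
    show "filterlim (\<lambda>n. nat (int n + i)) sequentially sequentially"
      unfolding filterlim_at_top
    proof
      fix Z
      show "eventually (\<lambda>n. Z \<le> nat (int n + i)) sequentially"
        using eventually_ge_at_top[of "nat (int Z - i)"] by eventually_elim auto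
    qed
  qed
  have "(\<lambda>n. qfact q (2 * n)) \<longlonglongrightarrow> qpoch_inf q q"
    by (rule filterlim_compose[OF lim]) (auto intro!: filterlim_subseq strict_monoI)
  hence "(\<lambda>n. qfact q (2 * n) / (qfact q (nat (int n + j)) * qfact q (nat (int n + (- j)))))
       \<longlonglongrightarrow> qpoch_inf q q / (qpoch_inf q q * qpoch_inf q q)"
    using nz by (intro tendsto_intros *) auto
  moreover have "eventually (\<lambda>n. qfact q (2 * n) / (qfact q (nat (int n + j)) * qfact q (nat (int n + (- j))))
       = qbinom q (2 * n) (nat (int n + j))) sequentially"
    using eventually_ge_at_top[of "nat \<bar>j\<bar>"]
  proof eventually_elim
    case (elim n)
    hence "nat (int n + j) \<le> 2 * n" "2 * n - nat (int n + j) = nat (int n + (- j))" by linarith+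
    thus ?case by (simp add: qbinom_def)
  qed
  ultimately show ?thesis
    using nz by (simp add: tendsto_cong)
qed

text \<open>Let \<open>n\<close> tend to infinity in the finite identity at \<open>w = - z\<close>.
  Dominated convergence moves the limit inside the sum, where every coefficient tends to
  \<open>1 / qpoch_inf q q\<close>.\<close>

theorem jacobi_triple_product:
  assumes "norm q < 1" "q \<noteq> 0" "z \<noteq> 0"
  shows "(theta_term q (- z) has_sum qpochs_inf [z, q / z, q] q) UNIV"
proof -
  define t where "t = theta_term q (- z)"
  \<comment> \<open>Extension by 0 outside the window turns the finite sums into series over one
    index set independent of \<open>n\<close>.\<close>
  define c where "c n j = (if j \<in> {-int n..int n} then qbinom q (2 * n) (nat (int n + j)) else 0)" for n j
  \<comment> \<open>Tannery's theorem concerns series over the naturals, so the integers are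
    enumerated; absolute summability makes the order irrelevant.\<close>
  define d :: "nat \<Rightarrow> int" where "d = int_decode"
  have bij: "bij_betw d UNIV UNIV" unfolding d_def by (rule bij_int_decode)
  have nz: "qpoch_inf q q \<noteq> 0" by (rule qpoch_inf_nonzero[OF assms(1) assms(1)])
  obtain M where M: "\<And>n k. norm (qbinom q n k) \<le> M" using qbinom_bounded[OF assms(1)] by blast
  have M0: "M \<ge> 0" using order_trans[OF norm_ge_zero M] .
  have abs: "(\<lambda>j. norm (t j)) summable_on UNIV"
    unfolding t_def using assms by (intro norm_theta_term_summable) auto
  hence "(\<lambda>k. norm (t (d k))) summable_on UNIV"
    by (subst summable_on_reindex_bij_betw[OF bij])
  hence summ: "summable (\<lambda>k. norm (t (d k)))" by (rule summable_on_imp_summable)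
  have lim_c: "(\<lambda>n. c n j) \<longlonglongrightarrow> 1 / qpoch_inf q q" for j
  proof -
    have "eventually (\<lambda>n. c n j = qbinom q (2 * n) (nat (int n + j))) sequentially"
      using eventually_ge_at_top[of "nat \<bar>j\<bar>"] by eventually_elim (auto simp: c_def)
    with qbinom_central_LIMSEQ[OF assms(1), of j] show ?thesis by (simp add: tendsto_cong)
  qed
  have "((\<lambda>n. \<Sum>k. t (d k) * c n (d k)) \<longlonglongrightarrow> (\<Sum>k. t (d k) * (1 / qpoch_inf q q)))"
  proof (rule tannerys_theorem[THEN conjunct2, THEN conjunct2])
    show "summable (\<lambda>k. norm (t (d k)) * M)" using summ by (rule summable_mult2)
    show "\<forall>\<^sub>F (k, n) in sequentially \<times>\<^sub>F sequentially. norm (t (d k) * c n (d k)) \<le> norm (t (d k)) * M"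
      using M M0 by (intro always_eventually) (auto simp: norm_mult c_def intro!: mult_left_mono)
  qed (use tendsto_mult_left[OF lim_c] in auto)
  moreover have "(\<Sum>k. t (d k) * c n (d k)) = (\<Prod>i<n. 1 - z * q ^ i) * (\<Prod>i<n. 1 - q / z * q ^ i)" for n
  proof -
    have "((\<lambda>j. t j * c n j) has_sum (\<Sum>j\<in>{-int n..int n}. t j * qbinom q (2 * n) (nat (int n + j)))) UNIV"
      by (rule has_sum_finite_neutralI[of "{-int n..int n}"]) (auto simp: c_def)
    hence "((\<lambda>k. t (d k) * c n (d k)) has_sum (\<Sum>j\<in>{-int n..int n}. t j * qbinom q (2 * n) (nat (int n + j)))) UNIV"
      by (subst has_sum_reindex_bij_betw[OF bij])
    hence "(\<Sum>k. t (d k) * c n (d k)) = (\<Sum>j\<in>{-int n..int n}. t j * qbinom q (2 * n) (nat (int n + j)))"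
      by (metis has_sum_imp_sums sums_unique)
    also have "\<dots> = (\<Prod>i<n. 1 + (-z) * q ^ i) * (\<Prod>i<n. 1 + q / (-z) * q ^ i)"
      unfolding t_def using assms by (intro finite_triple_product [symmetric]) auto
    finally show ?thesis by simp
  qed
  ultimately have "(\<lambda>n. (\<Prod>i<n. 1 - z * q ^ i) * (\<Prod>i<n. 1 - q / z * q ^ i))
      \<longlonglongrightarrow> (\<Sum>k. t (d k) * (1 / qpoch_inf q q))" by simp
  moreover have "(\<lambda>n. (\<Prod>i<n. 1 - z * q ^ i) * (\<Prod>i<n. 1 - q / z * q ^ i))
      \<longlonglongrightarrow> qpoch_inf z q * qpoch_inf (q / z) q"
    by (intro tendsto_mult qpoch_inf_LIMSEQ assms)
  ultimately have "(\<Sum>k. t (d k) * (1 / qpoch_inf q q)) = qpoch_inf z q * qpoch_inf (q / z) q"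
    by (rule LIMSEQ_unique)
  also have "(\<Sum>k. t (d k) * (1 / qpoch_inf q q)) = (\<Sum>k. t (d k)) * (1 / qpoch_inf q q)"
    using summable_norm_cancel[OF summ] by (rule suminf_mult2 [symmetric])
  finally have "(\<Sum>k. t (d k)) = qpochs_inf [z, q / z, q] q"
    using nz by (simp add: qpochs_inf_def field_simps)
  moreover have "((\<lambda>k. t (d k)) has_sum (\<Sum>k. t (d k))) UNIV"
    by (rule norm_summable_imp_has_sum[OF summ summable_sums[OF summable_norm_cancel[OF summ]]])
  ultimately show ?thesis
    using has_sum_reindex_bij_betw[OF bij, of t] by (simp add: t_def)
qed

section \<open>The quintuple product\<close>

lemma prod_lessThan_3: "(\<Prod>r<3. f r) = f 0 * f 1 * f 2" for f :: "nat \<Rightarrow> complex"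
  by (simp add: numeral_3_eq_3 numeral_2_eq_2)

text \<open>Sort the factors by their index modulo \<open>m\<close>. This is exact for partial
  products of length \<open>n * m\<close>, a subsequence with the same limit.\<close>

lemma qpoch_inf_residues:
  assumes "norm q < 1" "m > 0"
  shows "qpoch_inf a q = (\<Prod>r<m. qpoch_inf (a * q ^ r) (q ^ m))"
proof -
  have "(\<lambda>n. \<Prod>i<n*m. 1 - a * q ^ i) \<longlonglongrightarrow> qpoch_inf a q"
    using assms(2)
    by (intro filterlim_compose[OF qpoch_inf_LIMSEQ[OF assms(1)]] filterlim_subseq) (auto simp: strict_mono_def)
  moreover have "(\<Prod>i<n*m. 1 - a * q ^ i) = (\<Prod>r<m. \<Prod>i<n. 1 - (a * q ^ r) * (q ^ m) ^ i)" for n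
  proof (induction n)
    case (Suc n)
    have "(\<Prod>i<n*m+k. 1 - a * q ^ i) = (\<Prod>i<n*m. 1 - a * q ^ i) * (\<Prod>r<k. 1 - (a * q ^ r) * (q ^ m) ^ n)" for k
      by (induction k) (simp_all add: mult_ac power_add flip: power_mult)
    from this[of m] Suc show ?case by (simp add: prod.distrib add.commute)
  qed simp
  moreover have "(\<lambda>n. \<Prod>r<m. \<Prod>i<n. 1 - (a * q ^ r) * (q ^ m) ^ i)
      \<longlonglongrightarrow> (\<Prod>r<m. qpoch_inf (a * q ^ r) (q ^ m))"
    using assms by (intro tendsto_prod qpoch_inf_LIMSEQ) (auto simp: norm_power power_less_one_iff)
  ultimately show ?thesis using LIMSEQ_unique by fastforce
qed

lemma qpoch_inf_square:
  assumes "norm q < 1"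
  shows "qpoch_inf (a ^ 2) (q ^ 2) = qpoch_inf a q * qpoch_inf (- a) q"
proof -
  have "norm (q ^ 2) < 1" using assms by (simp add: norm_power power_less_one_iff)
  hence "(\<lambda>n. \<Prod>i<n. 1 - a ^ 2 * (q ^ 2) ^ i) \<longlonglongrightarrow> qpoch_inf (a ^ 2) (q ^ 2)"
    by (rule qpoch_inf_LIMSEQ)
  also have "(\<lambda>n. \<Prod>i<n. 1 - a ^ 2 * (q ^ 2) ^ i) = (\<lambda>n. (\<Prod>i<n. 1 - a * q ^ i) * (\<Prod>i<n. 1 - (-a) * q ^ i))"
    unfolding prod.distrib [symmetric]
    by (intro ext prod.cong refl) (simp add: algebra_simps power2_eq_square power_mult_distrib)
  finally show ?thesis
    by (rule LIMSEQ_unique) (intro tendsto_mult qpoch_inf_LIMSEQ assms)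
qed

lemma has_sum_int_residues:
  fixes g :: "int \<Rightarrow> complex" and m :: int
  assumes "(g has_sum S) UNIV" "m > 0"
  shows "((\<lambda>k. \<Sum>r\<in>{0..<m}. g (m * k + r)) has_sum S) UNIV"
proof (rule has_sum_SigmaD)
  show "((\<lambda>(k, r). g (m * k + r)) has_sum S) (UNIV \<times> {0..<m})"
    using assms(1)
  proof (subst has_sum_reindex_bij_witness[of _ "\<lambda>j. (j div m, j mod m)" "\<lambda>(k, r). m * k + r" UNIV g _ _ S])
  qed (use assms(2) in auto)
qed auto

lemma theta_term_minus: "theta_term q (- z) j = (-1) powi j * (q powi (j * (j - 1) div 2) * z powi j)"
  using power_int_mult_distrib[of "-1" z j] by (simp add: theta_term_def)

lemma theta_term_power:
  "q \<noteq> 0 \<Longrightarrow> theta_term (q ^ a) (- (q ^ b)) j = (-1) powi j * q powi (int a * (j * (j - 1) div 2) + int b * j)"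
  by (simp add: theta_term_minus power_int_power power_int_add)

text \<open>The left side is the exponent of \<open>q\<close> in the product of the two theta terms
  on the line \<open>N = 3 * k + r\<close>, at \<open>m = l + k\<close>. Shifting \<open>m\<close>
  by \<open>k\<close> recentres the line: the part depending on \<open>l\<close> is a theta exponent
  in base \<open>q ^ 6\<close> that involves only \<open>r\<close>.\<close>

lemma quintuple_exponent:
  fixes k l r :: int
  shows "(3 * k + r - 2 * (l + k)) * (3 * k + r - 2 * (l + k) - 1) div 2 + (l + k) * (l + k - 1) + (l + k)
     = (3 * k + r) * (3 * k + r - 1) div 2 - (3 * k^2 + (2 * r - 1) * k) + (6 * (l * (l - 1) div 2) + (4 - 2 * r) * l)"
proof -
  obtain X Y Z where XYZ: "X = (3 * k + r - 2 * (l + k)) * (3 * k + r - 2 * (l + k) - 1) div 2"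
      "Y = (3 * k + r) * (3 * k + r - 1) div 2" "Z = l * (l - 1) div 2" by blast
  have "2 * X = (3 * k + r - 2 * (l + k)) * (3 * k + r - 2 * (l + k) - 1)"
       "2 * Y = (3 * k + r) * (3 * k + r - 1)" "2 * Z = l * (l - 1)"
    unfolding XYZ by (rule triangle_double)+
  hence "2 * (X + (l + k) * (l + k - 1) + (l + k))
    = 2 * (Y - (3 * k^2 + (2 * r - 1) * k) + (6 * Z + (4 - 2 * r) * l))"
    by (simp add: algebra_simps power2_eq_square)
  thus ?thesis unfolding XYZ by simp
qed

text \<open>The product of the triple products for \<open>(z; q)\<close> and \<open>(q * z\<^sup>2; q\<^sup>2)\<close> is summed along the
  lines \<open>N = n + 2 * m\<close>. Each line carries a triple product in base \<open>q\<^sup>6\<close>, which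
  vanishes for \<open>N mod 3 = 2\<close> and is \<open>(q\<^sup>2; q\<^sup>2)\<close> up to a monomial otherwise.\<close>

theorem quintuple_product:
  assumes "norm q < 1" "q \<noteq> 0" "z \<noteq> 0"
  shows "((\<lambda>k. q powi (k * (3 * k - 1) div 2) * z powi (3 * k) * (1 - z * q powi k))
            has_sum (qpochs_inf [z, q / z, q] q * qpochs_inf [q * z ^ 2, q / z ^ 2] (q ^ 2))) UNIV"
proof -
  have norm_pow: "norm (q ^ n) < 1" if "n > 0" for n
    using assms(1) that by (simp add: norm_power power_less_one_iff)
  define s t where "s = theta_term q (- z)" and "t = theta_term (q ^ 2) (- (q * z ^ 2))"
  define S T where "S = qpochs_inf [z, q / z, q] q" and "T = qpochs_inf [q * z ^ 2, q / z ^ 2, q ^ 2] (q ^ 2)"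
  define E where "E = qpoch_inf (q ^ 2) (q ^ 2)"
  have E: "E \<noteq> 0" unfolding E_def by (intro qpoch_inf_nonzero norm_pow) auto
  have s: "(s has_sum S) UNIV"
    unfolding s_def S_def by (rule jacobi_triple_product[OF assms])
  have t: "(t has_sum T) UNIV"
    using jacobi_triple_product[of "q ^ 2" "q * z ^ 2"] norm_pow[of 2] assms
    by (simp add: t_def T_def power2_eq_square)
  \<comment> \<open>Absolute summability of the double family permits summing it along lines instead
    of rows.\<close>
  have "(\<lambda>x. norm (case x of (n, m) \<Rightarrow> s n * t m)) summable_on UNIV \<times> UNIV"
  proof (rule summable_on_SigmaI)
    have "(\<lambda>n. norm (s n)) summable_on UNIV" "(\<lambda>m. norm (t m)) summable_on UNIV"
      unfolding s_def t_def using assms norm_pow[of 2] by (auto intro!: norm_theta_term_summable)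
    thus "(\<lambda>n. norm (s n) * (\<Sum>\<^sub>\<infinity>m. norm (t m))) summable_on UNIV"
      and "((\<lambda>m. norm (case (n, m) of (n, m) \<Rightarrow> s n * t m)) has_sum (norm (s n) * (\<Sum>\<^sub>\<infinity>m. norm (t m)))) UNIV" for n
      by (auto simp: norm_mult intro!: summable_on_cmult_left has_sum_cmult_right)
  qed auto
  hence "(\<lambda>(n, m). s n * t m) summable_on UNIV \<times> UNIV"
    by (rule abs_summable_summable)
  hence "((\<lambda>(n, m). s n * t m) has_sum (S * T)) (UNIV \<times> UNIV)"
    by (intro has_sum_SigmaI[where g = "\<lambda>n. s n * T"])
       (auto intro!: has_sum_cmult_right has_sum_cmult_left s t)
  hence *: "((\<lambda>(N, m). s (N - 2 * m) * t m) has_sum (S * T)) (UNIV \<times> UNIV)"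
    by (subst has_sum_reindex_bij_witness[of _ "\<lambda>(n, m). (n + 2 * m, m)" "\<lambda>(N, m). (N - 2 * m, m)"
          "UNIV \<times> UNIV" "\<lambda>(n, m). s n * t m" _ _ "S * T"]) auto
  \<comment> \<open>The monomial common to all terms on the line \<open>N = 3 * k + r\<close>. The
    power of \<open>z\<close> is constant there because \<open>n + 2 * m = N\<close>.\<close>
  define C where "C k r = (-1) powi r * q powi ((3 * k + r) * (3 * k + r - 1) div 2 - (3 * k^2 + (2 * r - 1) * k))
      * z powi (3 * k + r)" for k r :: int
  have st: "s (3 * k + r - 2 * (l + k)) * t (l + k) = C k r * theta_term (q ^ 6) (- (q ^ nat (4 - 2 * r))) l"
    if "r \<in> {0..<3}" for k r l
  proof -
    have sgn: "(-1) powi (3 * k + r - 2 * (l + k)) * (-1) powi (l + k) = (-1) powi r * (-1 :: complex) powi l"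
      by (cases "even r"; cases "even k"; cases "even l") auto
    have zz: "z powi (3 * k + r - 2 * (l + k)) * z powi (2 * (l + k)) = z powi (3 * k + r)"
      using assms by (simp flip: power_int_add)
    have qq: "q powi ((3 * k + r - 2 * (l + k)) * (3 * k + r - 2 * (l + k) - 1) div 2)
        * q powi ((l + k) * (l + k - 1)) * q powi (l + k)
      = q powi ((3 * k + r) * (3 * k + r - 1) div 2 - (3 * k^2 + (2 * r - 1) * k))
        * q powi (6 * (l * (l - 1) div 2) + (4 - 2 * r) * l)"
      using assms by (simp only: power_int_add [symmetric] quintuple_exponent simp_thms)
    have tt: "t j = (-1) powi j * (q powi (j * (j - 1)) * q powi j * z powi (2 * j))" for j
      unfolding t_def theta_term_minus power_int_mult_distrib power_int_power
      using triangle_double[of j] by (simp add: mult_ac)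
    have th: "theta_term (q ^ 6) (- (q ^ nat (4 - 2 * r))) l
        = (-1) powi l * q powi (6 * (l * (l - 1) div 2) + (4 - 2 * r) * l)"
      using assms that by (simp add: theta_term_power del: minus_mult_minus)
    show ?thesis
      unfolding th tt C_def
      unfolding s_def theta_term_minus
      using arg_cong2[OF arg_cong2[OF sgn qq, of times] zz, of times] by (simp only: mult_ac)
  qed
  define g where "g N = C (N div 3) (N mod 3) * (if N mod 3 = 2 then 0 else E)" for N
  have "(g has_sum (S * T)) UNIV"
  proof (rule has_sum_SigmaD[OF *])
    fix N :: int
    define k r where "k = N div 3" and "r = N mod 3"
    have N: "N = 3 * k + r" and r: "r \<in> {0..<3}" by (auto simp: k_def r_def)
    have "(theta_term (q ^ 6) (- (q ^ nat (4 - 2 * r)))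
        has_sum qpochs_inf [q ^ nat (4 - 2 * r), q ^ 6 / q ^ nat (4 - 2 * r), q ^ 6] (q ^ 6)) UNIV"
      using assms norm_pow by (intro jacobi_triple_product) auto
    \<comment> \<open>For \<open>r = 0\<close> and \<open>r = 1\<close> the arguments are
      \<open>q ^ 4\<close> and \<open>q ^ 2\<close> in either order, which with \<open>q ^ 6\<close>
      make up \<open>E\<close>. For \<open>r = 2\<close> the first argument is 1, so the product has
      a zero factor.\<close>
    also have "qpochs_inf [q ^ nat (4 - 2 * r), q ^ 6 / q ^ nat (4 - 2 * r), q ^ 6] (q ^ 6)
       = (if r = 2 then 0 else E)"
    proof -
      have E: "E = qpoch_inf (q ^ 2) (q ^ 6) * qpoch_inf (q ^ 4) (q ^ 6) * qpoch_inf (q ^ 6) (q ^ 6)"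
        unfolding E_def using qpoch_inf_residues[of "q ^ 2" 3 "q ^ 2"] norm_pow[of 2]
        by (simp only: prod_lessThan_3 power_mult [symmetric] power_add [symmetric]) simp
      have 1: "qpoch_inf 1 (q ^ 6) = 0"
      proof -
        have "(\<lambda>i. 1 - 1 * (q ^ 6) ^ i) has_prod qpoch_inf 1 (q ^ 6)"
          unfolding qpoch_inf_def using norm_pow[of 6] by (intro convergent_prod_has_prod qpoch_inf_convergent) auto
        thus ?thesis by (rule has_prod_zeroI[of _ _ 0]) simp
      qed
      have "r = 0 \<or> r = 1 \<or> r = 2" using r by auto
      moreover have "q ^ 6 / q ^ 4 = q ^ 2" "q ^ 6 / q ^ 2 = q ^ 4"
        using assms by (simp_all add: divide_simps flip: power_add)
      ultimately show ?thesis using E 1 by (auto simp: qpochs_inf_def)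
    qed
    finally have "((\<lambda>l. C k r * theta_term (q ^ 6) (- (q ^ nat (4 - 2 * r))) l) has_sum g N) UNIV"
      unfolding g_def k_def r_def by (rule has_sum_cmult_right)
    hence "((\<lambda>l. s (N - 2 * (l + k)) * t (l + k)) has_sum g N) UNIV"
      unfolding N st[OF r] .
    thus "((\<lambda>m. case (N, m) of (N, m) \<Rightarrow> s (N - 2 * m) * t m) has_sum g N) UNIV"
      by (subst has_sum_reindex_bij_witness[of _ "\<lambda>l. l + k" "\<lambda>m. m - k" UNIV "\<lambda>l. s (N - 2 * (l + k)) * t (l + k)" _ _ "g N"]) auto
  qed
  hence "((\<lambda>k. \<Sum>r\<in>{0..<3}. g (3 * k + r)) has_sum (S * T)) UNIV"
    by (rule has_sum_int_residues) simp
  \<comment> \<open>The lines with \<open>r = 0\<close> and \<open>r = 1\<close> give the two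
    summands of \<open>1 - z * q powi k\<close>; the factor \<open>E\<close> is cancelled against
    the one contained in \<open>T\<close>.\<close>
  moreover have "(\<Sum>r\<in>{0..<3}. g (3 * k + r)) = E * (q powi (k * (3 * k - 1) div 2) * z powi (3 * k) * (1 - z * q powi k))" for k
  proof -
    have "{0..<3::int} = {0, 1, 2}" by auto
    moreover have "g (3 * k) = E * (q powi (k * (3 * k - 1) div 2) * z powi (3 * k))"
    proof -
      have "3 * k * (3 * k - 1) div 2 - (3 * k^2 - k) = k * (3 * k - 1) div 2"
        by (simp add: algebra_simps power2_eq_square)
      thus ?thesis by (simp add: g_def C_def)
    qed
    moreover have "g (3 * k + 1) = - E * (q powi (k * (3 * k - 1) div 2) * q powi k * (z powi (3 * k) * z))"
    proof -
      have "(3 * k + 1) * (3 * k) div 2 - (3 * k^2 + k) = k * (3 * k - 1) div 2 + k"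
        by (simp add: algebra_simps power2_eq_square)
      hence "q powi ((3 * k + 1) * (3 * k) div 2 - (3 * k^2 + k)) = q powi (k * (3 * k - 1) div 2) * q powi k"
        using assms(2) by (simp only: power_int_add simp_thms)
      thus ?thesis using assms by (simp add: g_def C_def power_int_add)
    qed
    moreover have "g (3 * k + 2) = 0" by (simp add: g_def)
    ultimately show ?thesis by (simp add: algebra_simps)
  qed
  ultimately have "((\<lambda>k. E * (q powi (k * (3 * k - 1) div 2) * z powi (3 * k) * (1 - z * q powi k))) has_sum (S * T)) UNIV"
    by simp
  moreover have "S * T = E * (S * qpochs_inf [q * z ^ 2, q / z ^ 2] (q ^ 2))"
    by (simp add: T_def E_def qpochs_inf_def)
  ultimately show ?thesis
    using E unfolding S_def by (simp add: has_sum_cmult_right_iff)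
qed

section \<open>Auxiliary facts on powers and bilateral sums\<close>

lemma norm_power_less_one: "norm (x ^ n) < 1" if "norm x < 1" "n > 0" for x :: complex
  using that by (simp add: norm_power power_less_one_iff)

lemma theta_term_power':
  "q \<noteq> 0 \<Longrightarrow> theta_term (q ^ a) (q ^ b) j = q powi (int a * (j * (j - 1) div 2) + int b * j)"
  by (simp add: theta_term_def power_int_power power_int_add)

lemma power_divide_power: "x \<noteq> 0 \<Longrightarrow> m \<le> n \<Longrightarrow> x ^ n / x ^ m = x ^ (n - m)" for x :: complex
  by (simp add: power_diff)

lemma has_sum_reflect:
  fixes f :: "int \<Rightarrow> complex"
  shows "((\<lambda>k. f (c - k)) has_sum S) UNIV \<longleftrightarrow> (f has_sum S) UNIV"
  by (rule has_sum_reindex_bij_witness[of _ "\<lambda>k. c - k" "\<lambda>k. c - k"]) auto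

lemma has_sum_diff:
  fixes f g :: "'a \<Rightarrow> complex"
  assumes "(f has_sum a) A" "(g has_sum b) A"
  shows "((\<lambda>x. f x - g x) has_sum (a - b)) A"
  using has_sum_add[OF assms(1) has_sum_uminusI[OF assms(2)]] by simp

section \<open>Even parts\<close>

text \<open>Split the triple product series in base \<open>x ^ 5\<close> at \<open>z = x\<close> by
  the parity of the index. Even indices lose their sign and give a theta series in base
  \<open>x ^ 20\<close> at \<open>x ^ 7\<close>; odd indices, after \<open>k\<close> becomes
  \<open>- k\<close>, give \<open>- x\<close> times the one at \<open>x ^ 3\<close>.\<close>

lemma theta_dissection:
  assumes "norm x < 1" "x \<noteq> 0"
  shows "qpochs_inf [x, x ^ 4, x ^ 5] (x ^ 5)
       = qpochs_inf [- (x ^ 7), - (x ^ 13), x ^ 20] (x ^ 20)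
         - x * qpochs_inf [- (x ^ 3), - (x ^ 17), x ^ 20] (x ^ 20)"
proof -
  have even_term: "20 * (k * (k - 1) div 2) + 7 * k = 5 * (2 * k * (2 * k - 1) div 2) + 2 * k" for k :: int
  proof -
    obtain S T where ST: "S = k * (k - 1) div 2" "T = 2 * k * (2 * k - 1) div 2" by blast
    have "2 * S = k * (k - 1)" "2 * T = 2 * k * (2 * k - 1)" unfolding ST by (rule triangle_double)+
    thus ?thesis unfolding ST [symmetric] by (simp add: algebra_simps)
  qed
  have odd_term: "20 * (-k * (-k - 1) div 2) + 3 * (- k) + 1
      = 5 * ((2 * k + 1) * (2 * k + 1 - 1) div 2) + (2 * k + 1)" for k :: int
  proof -
    obtain S T where ST: "S = - k * (- k - 1) div 2" "T = (2 * k + 1) * (2 * k + 1 - 1) div 2" by blast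
    have "2 * S = - k * (- k - 1)" "2 * T = (2 * k + 1) * (2 * k + 1 - 1)" unfolding ST by (rule triangle_double)+
    thus ?thesis unfolding ST [symmetric] by (simp add: algebra_simps)
  qed
  have "(theta_term (x ^ 5) (- (x ^ 1)) has_sum qpochs_inf [x, x ^ 4, x ^ 5] (x ^ 5)) UNIV"
    using jacobi_triple_product[of "x ^ 5" x] assms norm_power_less_one[of x 5] power_divide_power[of x 1 5] by simp
  hence 1: "((\<lambda>k. \<Sum>r\<in>{0..<2}. theta_term (x ^ 5) (- (x ^ 1)) (2 * k + r))
      has_sum qpochs_inf [x, x ^ 4, x ^ 5] (x ^ 5)) UNIV"
    by (rule has_sum_int_residues) simp
  have 2: "(theta_term (x ^ 20) (x ^ 7) has_sum qpochs_inf [- (x ^ 7), - (x ^ 13), x ^ 20] (x ^ 20)) UNIV"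
    using jacobi_triple_product[of "x ^ 20" "- (x ^ 7)"] assms norm_power_less_one[of x 20] power_divide_power[of x 7 20]
    by simp
  have "(theta_term (x ^ 20) (x ^ 3) has_sum qpochs_inf [- (x ^ 3), - (x ^ 17), x ^ 20] (x ^ 20)) UNIV"
    using jacobi_triple_product[of "x ^ 20" "- (x ^ 3)"] assms norm_power_less_one[of x 20] power_divide_power[of x 3 20]
    by simp
  hence "((\<lambda>k. theta_term (x ^ 20) (x ^ 3) (0 - k)) has_sum qpochs_inf [- (x ^ 3), - (x ^ 17), x ^ 20] (x ^ 20)) UNIV"
    by (subst has_sum_reflect)
  hence "((\<lambda>k. theta_term (x ^ 20) (x ^ 7) k - x * theta_term (x ^ 20) (x ^ 3) (0 - k)) has_sum
      (qpochs_inf [- (x ^ 7), - (x ^ 13), x ^ 20] (x ^ 20)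
         - x * qpochs_inf [- (x ^ 3), - (x ^ 17), x ^ 20] (x ^ 20))) UNIV"
    by (intro has_sum_diff has_sum_cmult_right 2)
  moreover have "theta_term (x ^ 20) (x ^ 7) k - x * theta_term (x ^ 20) (x ^ 3) (0 - k)
      = (\<Sum>r\<in>{0..<2}. theta_term (x ^ 5) (- (x ^ 1)) (2 * k + r))" for k
  proof -
    have "{0..<2::int} = {0, 1}" by auto
    moreover have "theta_term (x ^ 20) (x ^ 7) k = theta_term (x ^ 5) (- (x ^ 1)) (2 * k)"
    proof -
      have "(-1) powi (2 * k) = (1 :: complex)" by simp
      thus ?thesis
        by (simp only: theta_term_power'[OF assms(2)] theta_term_power[OF assms(2)] of_nat_numeral of_nat_1
              mult_1_left even_term)
    qed
    moreover have "x * theta_term (x ^ 20) (x ^ 3) (0 - k) = - theta_term (x ^ 5) (- (x ^ 1)) (2 * k + 1)"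
    proof -
      have "x * theta_term (x ^ 20) (x ^ 3) (0 - k) = x powi (20 * (-k * (-k - 1) div 2) + 3 * (- k) + 1)"
        unfolding theta_term_power'[OF assms(2)] using assms(2) by (simp add: power_int_add)
      thus ?thesis unfolding theta_term_power[OF assms(2)] odd_term by simp
    qed
    ultimately show ?thesis by simp
  qed
  ultimately show ?thesis using 1 has_sum_unique by fastforce
qed

text \<open>Each factor in base \<open>x ^ 40\<close> splits as a difference of squares in base
  \<open>x ^ 20\<close>. The factors without minus sign complete both products to the same
  \<open>(x^3, x^7; x^10)\<close>, and what remains is the dissected theta function. Multiplying by
  \<open>(x^2, x^8; x^10)\<close> restores all residues modulo 5.\<close>

lemma quintuple_difference:
  assumes "norm x < 1" "x \<noteq> 0"
  shows "(qpochs_inf [x ^ 3, x ^ 17, x ^ 20] (x ^ 20) * qpochs_inf [x ^ 26, x ^ 14] (x ^ 40)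
         - x * (qpochs_inf [x ^ 7, x ^ 13, x ^ 20] (x ^ 20) * qpochs_inf [x ^ 34, x ^ 6] (x ^ 40)))
         * qpochs_inf [x ^ 2, x ^ 8] (x ^ 10) = qpoch_inf x x"
proof -
  have sq: "qpoch_inf (x ^ (2 * a)) (x ^ 40) = qpoch_inf (x ^ a) (x ^ 20) * qpoch_inf (- (x ^ a)) (x ^ 20)" for a
    using qpoch_inf_square[of "x ^ 20" "x ^ a"] norm_power_less_one[of x 20] assms
    by (simp flip: power_mult add: mult.commute)
  have two: "qpoch_inf (x ^ a) (x ^ b) = qpoch_inf (x ^ a) (x ^ (2 * b)) * qpoch_inf (x ^ (a + b)) (x ^ (2 * b))"
    if "b > 0" for a b
    using qpoch_inf_residues[of "x ^ b" 2 "x ^ a"] norm_power_less_one[of x b] assms that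
    by (simp add: numeral_2_eq_2 mult.commute power_add flip: power_mult)
  have five: "qpoch_inf x x = qpoch_inf x (x ^ 5) * qpoch_inf (x ^ 2) (x ^ 5) * qpoch_inf (x ^ 3) (x ^ 5)
      * qpoch_inf (x ^ 4) (x ^ 5) * qpoch_inf (x ^ 5) (x ^ 5)"
    using qpoch_inf_residues[of x 5 x] assms by (simp add: eval_nat_numeral mult_ac)
  have sqs: "qpoch_inf (x ^ 26) (x ^ 40) = qpoch_inf (x ^ 13) (x ^ 20) * qpoch_inf (- (x ^ 13)) (x ^ 20)"
     "qpoch_inf (x ^ 14) (x ^ 40) = qpoch_inf (x ^ 7) (x ^ 20) * qpoch_inf (- (x ^ 7)) (x ^ 20)"
     "qpoch_inf (x ^ 34) (x ^ 40) = qpoch_inf (x ^ 17) (x ^ 20) * qpoch_inf (- (x ^ 17)) (x ^ 20)"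
     "qpoch_inf (x ^ 6) (x ^ 40) = qpoch_inf (x ^ 3) (x ^ 20) * qpoch_inf (- (x ^ 3)) (x ^ 20)"
    using sq[of 13] sq[of 7] sq[of 17] sq[of 3] by simp_all
  have twos: "qpoch_inf (x ^ 3) (x ^ 10) = qpoch_inf (x ^ 3) (x ^ 20) * qpoch_inf (x ^ 13) (x ^ 20)"
     "qpoch_inf (x ^ 7) (x ^ 10) = qpoch_inf (x ^ 7) (x ^ 20) * qpoch_inf (x ^ 17) (x ^ 20)"
     "qpoch_inf (x ^ 2) (x ^ 5) = qpoch_inf (x ^ 2) (x ^ 10) * qpoch_inf (x ^ 7) (x ^ 10)"
     "qpoch_inf (x ^ 3) (x ^ 5) = qpoch_inf (x ^ 3) (x ^ 10) * qpoch_inf (x ^ 8) (x ^ 10)"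
    using two[of 10 3] two[of 10 7] two[of 5 2] two[of 5 3] by simp_all
  have "qpochs_inf [x ^ 3, x ^ 17, x ^ 20] (x ^ 20) * qpochs_inf [x ^ 26, x ^ 14] (x ^ 40)
         - x * (qpochs_inf [x ^ 7, x ^ 13, x ^ 20] (x ^ 20) * qpochs_inf [x ^ 34, x ^ 6] (x ^ 40))
       = qpoch_inf (x ^ 3) (x ^ 10) * qpoch_inf (x ^ 7) (x ^ 10) * qpochs_inf [x, x ^ 4, x ^ 5] (x ^ 5)"
    unfolding theta_dissection[OF assms] by (simp add: qpochs_inf_def sqs twos algebra_simps)
  also have "\<dots> * qpochs_inf [x ^ 2, x ^ 8] (x ^ 10) = qpoch_inf x x"
    unfolding five twos(3,4) by (simp add: qpochs_inf_def)
  finally show ?thesis .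
qed

text \<open>The quintuple product in base \<open>x ^ a\<close> at \<open>z = x ^ b\<close>;
  \<open>2 * b \<le> a\<close> keeps \<open>a - 2 * b\<close> a genuine difference of
  naturals.\<close>

lemma quintuple_product_power:
  assumes "norm x < 1" "x \<noteq> 0" "2 * b \<le> a" "a > 0"
  shows "((\<lambda>k. x powi (int a * (k * (3 * k - 1) div 2) + 3 * int b * k)
             - x powi (int a * (k * (3 * k - 1) div 2) + 3 * int b * k + int b + int a * k))
     has_sum (qpochs_inf [x ^ b, x ^ (a - b), x ^ a] (x ^ a)
              * qpochs_inf [x ^ (a + 2 * b), x ^ (a - 2 * b)] (x ^ (2 * a)))) UNIV"
proof -
  have "((\<lambda>k. (x ^ a) powi (k * (3 * k - 1) div 2) * (x ^ b) powi (3 * k) * (1 - x ^ b * (x ^ a) powi k))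
            has_sum (qpochs_inf [x ^ b, x ^ a / x ^ b, x ^ a] (x ^ a)
              * qpochs_inf [x ^ a * (x ^ b) ^ 2, x ^ a / (x ^ b) ^ 2] ((x ^ a) ^ 2))) UNIV"
    using assms norm_power_less_one[of x a] by (intro quintuple_product) auto
  moreover have "x ^ a / x ^ b = x ^ (a - b)" "x ^ a / (x ^ b) ^ 2 = x ^ (a - 2 * b)"
      "x ^ a * (x ^ b) ^ 2 = x ^ (a + 2 * b)" "(x ^ a) ^ 2 = x ^ (2 * a)"
    using assms by (simp_all add: power_diff power_add mult.commute flip: power_mult)
  moreover have "(x ^ a) powi (k * (3 * k - 1) div 2) * (x ^ b) powi (3 * k) * (1 - x ^ b * (x ^ a) powi k)
     = x powi (int a * (k * (3 * k - 1) div 2) + 3 * int b * k)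
             - x powi (int a * (k * (3 * k - 1) div 2) + 3 * int b * k + int b + int a * k)" for k
    using assms(2) by (simp add: power_int_power power_int_add algebra_simps)
  ultimately show ?thesis by simp
qed

lemma euler_quotient_series:
  assumes "norm x < 1" "x \<noteq> 0"
  shows "((\<lambda>k. x powi (30 * k ^ 2 - k) - x powi (30 * k ^ 2 + 19 * k + 3)
             - x powi (30 * k ^ 2 + 11 * k + 1) + x powi (30 * k ^ 2 + 31 * k + 8))
          has_sum (qpoch_inf x x / qpochs_inf [x ^ 2, x ^ 8] (x ^ 10))) UNIV"
proof -
  have pent: "20 * (k * (3 * k - 1) div 2) = 30 * k ^ 2 - 10 * k" for k :: int
    using arg_cong[OF pentagonal_double[of k], of "\<lambda>n. 10 * n"]
    by (simp only: mult.assoc [symmetric]) (simp add: algebra_simps power2_eq_square)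
  have "((\<lambda>k. x powi (20 * (k * (3 * k - 1) div 2) + 9 * k) - x powi (20 * (k * (3 * k - 1) div 2) + 9 * k + 3 + 20 * k)
       - x * (x powi (20 * (k * (3 * k - 1) div 2) + 21 * k) - x powi (20 * (k * (3 * k - 1) div 2) + 21 * k + 7 + 20 * k)))
     has_sum (qpochs_inf [x ^ 3, x ^ 17, x ^ 20] (x ^ 20) * qpochs_inf [x ^ 26, x ^ 14] (x ^ 40)
         - x * (qpochs_inf [x ^ 7, x ^ 13, x ^ 20] (x ^ 20) * qpochs_inf [x ^ 34, x ^ 6] (x ^ 40)))) UNIV"
    using quintuple_product_power[OF assms, of 3 20] quintuple_product_power[OF assms, of 7 20]
    by (intro has_sum_diff has_sum_cmult_right) simp_all
  also have "(qpochs_inf [x ^ 3, x ^ 17, x ^ 20] (x ^ 20) * qpochs_inf [x ^ 26, x ^ 14] (x ^ 40)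
         - x * (qpochs_inf [x ^ 7, x ^ 13, x ^ 20] (x ^ 20) * qpochs_inf [x ^ 34, x ^ 6] (x ^ 40)))
     = qpoch_inf x x / qpochs_inf [x ^ 2, x ^ 8] (x ^ 10)"
  proof -
    have "qpochs_inf [x ^ 2, x ^ 8] (x ^ 10) \<noteq> 0"
      using assms by (simp add: qpochs_inf_def qpoch_inf_nonzero norm_power_less_one)
    with quintuple_difference[OF assms] show ?thesis by (simp add: field_simps)
  qed
  also have "(\<lambda>k. x powi (20 * (k * (3 * k - 1) div 2) + 9 * k) - x powi (20 * (k * (3 * k - 1) div 2) + 9 * k + 3 + 20 * k)
       - x * (x powi (20 * (k * (3 * k - 1) div 2) + 21 * k) - x powi (20 * (k * (3 * k - 1) div 2) + 21 * k + 7 + 20 * k)))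
     = (\<lambda>k. x powi (30 * k ^ 2 - k) - x powi (30 * k ^ 2 + 19 * k + 3)
             - x powi (30 * k ^ 2 + 11 * k + 1) + x powi (30 * k ^ 2 + 31 * k + 8))"
  proof
    fix k :: int
    have "x * x powi i = x powi (i + 1)" for i
      using assms by (simp add: power_int_add)
    thus "x powi (20 * (k * (3 * k - 1) div 2) + 9 * k) - x powi (20 * (k * (3 * k - 1) div 2) + 9 * k + 3 + 20 * k)
       - x * (x powi (20 * (k * (3 * k - 1) div 2) + 21 * k) - x powi (20 * (k * (3 * k - 1) div 2) + 21 * k + 7 + 20 * k))
     = x powi (30 * k ^ 2 - k) - x powi (30 * k ^ 2 + 19 * k + 3)
             - x powi (30 * k ^ 2 + 11 * k + 1) + x powi (30 * k ^ 2 + 31 * k + 8)"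
      unfolding pent by (simp add: right_diff_distrib) (simp add: algebra_simps)
  qed
  finally show ?thesis .
qed

lemma even_part_power_int:
  "(x powi n + (- x) powi n) / 2 = (if even n then (x ^ 2) powi (n div 2) else 0)" for x :: complex
  by (auto simp: power_int_power)

lemma euler_even_part_quotient_series:
  assumes "norm x < 1" "x \<noteq> 0" and q: "q = x ^ 2"
  shows "((\<lambda>k. q powi (60 * k ^ 2 - k) + q powi (60 * k ^ 2 + 31 * k + 4)
             - q powi (60 * k ^ 2 + 79 * k + 26) - q powi (60 * k ^ 2 + 71 * k + 21))
          has_sum ((qpoch_inf x x + qpoch_inf (- x) (- x)) / 2 / qpochs_inf [q, q ^ 4] (q ^ 5))) UNIV"
proof -
  define e where "e n = (x powi n + (- x) powi n) / 2" for n
  have e: "e n = (if even n then q powi (n div 2) else 0)" for n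
    unfolding e_def q by (rule even_part_power_int)
  define u where "u x k = x powi (30 * k ^ 2 - k) - x powi (30 * k ^ 2 + 19 * k + 3)
             - x powi (30 * k ^ 2 + 11 * k + 1) + x powi (30 * k ^ 2 + 31 * k + 8)" for x :: complex and k :: int
  have "(u y has_sum (qpoch_inf y y / qpochs_inf [q, q ^ 4] (q ^ 5))) UNIV" if "y = x \<or> y = - x" for y
    using euler_quotient_series[of y] assms that by (auto simp: u_def [abs_def] simp flip: power_mult)
  hence "((\<lambda>k. (u x k + u (- x) k) * (1 / 2)) has_sum
     ((qpoch_inf x x / qpochs_inf [q, q ^ 4] (q ^ 5) + qpoch_inf (- x) (- x) / qpochs_inf [q, q ^ 4] (q ^ 5)) * (1 / 2))) UNIV"
    by (intro has_sum_add has_sum_cmult_left) auto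
  also have "(qpoch_inf x x / qpochs_inf [q, q ^ 4] (q ^ 5) + qpoch_inf (- x) (- x) / qpochs_inf [q, q ^ 4] (q ^ 5)) * (1 / 2)
     = (qpoch_inf x x + qpoch_inf (- x) (- x)) / 2 / qpochs_inf [q, q ^ 4] (q ^ 5)"
    by (simp add: add_divide_distrib mult.commute)
  finally have "((\<lambda>k. \<Sum>r\<in>{0..<2}. (u x (2 * k + r) + u (- x) (2 * k + r)) * (1 / 2)) has_sum
     ((qpoch_inf x x + qpoch_inf (- x) (- x)) / 2 / qpochs_inf [q, q ^ 4] (q ^ 5))) UNIV"
    by (intro has_sum_int_residues) auto
  also have "(\<lambda>k. \<Sum>r\<in>{0..<2}. (u x (2 * k + r) + u (- x) (2 * k + r)) * (1 / 2))
     = (\<lambda>k. q powi (60 * k ^ 2 - k) + q powi (60 * k ^ 2 + 31 * k + 4)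
             - q powi (60 * k ^ 2 + 79 * k + 26) - q powi (60 * k ^ 2 + 71 * k + 21))"
  proof
    fix k :: int
    \<comment> \<open>Modulo 2 the four exponents are \<open>j\<close>, \<open>j + 1\<close>,
      \<open>j + 1\<close>, \<open>j\<close>: even \<open>j\<close> keeps the first and the last,
      both positive, and odd \<open>j\<close> keeps the two negative ones.\<close>
    have u: "(u x j + u (- x) j) * (1 / 2) = e (30 * j ^ 2 - j) - e (30 * j ^ 2 + 19 * j + 3)
             - e (30 * j ^ 2 + 11 * j + 1) + e (30 * j ^ 2 + 31 * j + 8)" for j
      by (simp add: u_def e_def field_simps)
    have "{0..<2::int} = {0, 1}" by auto
    moreover have "30 * (2 * k) ^ 2 - 2 * k = 2 * (60 * k ^ 2 - k)"
      "30 * (2 * k) ^ 2 + 31 * (2 * k) + 8 = 2 * (60 * k ^ 2 + 31 * k + 4)"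
      "30 * (2 * k + 1) ^ 2 + 19 * (2 * k + 1) + 3 = 2 * (60 * k ^ 2 + 79 * k + 26)"
      "30 * (2 * k + 1) ^ 2 + 11 * (2 * k + 1) + 1 = 2 * (60 * k ^ 2 + 71 * k + 21)"
      by (simp_all add: power2_eq_square algebra_simps)
    ultimately show "(\<Sum>r\<in>{0..<2}. (u x (2 * k + r) + u (- x) (2 * k + r)) * (1 / 2))
       = q powi (60 * k ^ 2 - k) + q powi (60 * k ^ 2 + 31 * k + 4)
             - q powi (60 * k ^ 2 + 79 * k + 26) - q powi (60 * k ^ 2 + 71 * k + 21)"
      unfolding u by (simp only:) (simp add: e add_ac)
  qed
  finally show ?thesis .
qed

section \<open>The even part of Euler's product\<close>

lemma summable_quadratic_power:
  fixes q :: complex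
  assumes "norm q < 1" "q \<noteq> 0" "a > 0"
  shows "(\<lambda>k. q powi (int a * k ^ 2 + b * k + c)) summable_on UNIV"
proof -
  have "(\<lambda>k. norm (theta_term (q ^ (2 * a)) (q powi (int a + b)) k)) summable_on UNIV"
    using assms by (intro norm_theta_term_summable norm_power_less_one) auto
  hence "theta_term (q ^ (2 * a)) (q powi (int a + b)) summable_on UNIV"
    by (rule abs_summable_summable)
  hence "(\<lambda>k. q powi c * theta_term (q ^ (2 * a)) (q powi (int a + b)) k) summable_on UNIV"
    by (rule summable_on_cmult_right)
  moreover have "q powi c * theta_term (q ^ (2 * a)) (q powi (int a + b)) k = q powi (int a * k ^ 2 + b * k + c)" for k
  proof -
    \<comment> \<open>Rewriting the quadratic through triangular numbers exhibits a theta exponent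
      with base \<open>q ^ (2 * a)\<close> and argument \<open>q powi (a + b)\<close>.\<close>
    have "int a * k ^ 2 + b * k + c = c + (int (2 * a) * (k * (k - 1) div 2) + (int a + b) * k)"
      using triangle_double[of k] by (simp add: algebra_simps power2_eq_square)
    moreover have "theta_term (q ^ (2 * a)) (q powi (int a + b)) k
        = q powi (int (2 * a) * (k * (k - 1) div 2)) * q powi ((int a + b) * k)"
      by (simp only: theta_term_def power_int_power power_int_mult)
    ultimately show ?thesis
      using assms(2) by (simp only: power_int_add simp_thms)
  qed
  ultimately show ?thesis by simp
qed

text \<open>The triple product in base \<open>x ^ 3\<close> at \<open>z = x\<close>, whose three
  factors cover all residues modulo 3.\<close>

lemma pentagonal_number_theorem:
  assumes "norm x < 1" "x \<noteq> 0"
  shows "((\<lambda>k. (-1) powi k * x powi (3 * (k * (k - 1) div 2) + k)) has_sum qpoch_inf x x) UNIV"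
proof -
  have "qpoch_inf x x = qpochs_inf [x, x ^ 2, x ^ 3] (x ^ 3)"
    using qpoch_inf_residues[of x 3 x] assms by (simp add: eval_nat_numeral mult_ac qpochs_inf_def)
  moreover have "(theta_term (x ^ 3) (- (x ^ 1)) has_sum qpochs_inf [x, x ^ 2, x ^ 3] (x ^ 3)) UNIV"
    using jacobi_triple_product[of "x ^ 3" x] assms norm_power_less_one[of x 3] power_divide_power[of x 1 3] by simp
  moreover have "theta_term (x ^ 3) (- (x ^ 1)) = (\<lambda>k. (-1) powi k * x powi (3 * (k * (k - 1) div 2) + k))"
    by (intro ext) (subst theta_term_power[OF assms(2)], simp)
  ultimately show ?thesis by simp
qed

lemma euler_even_part:
  assumes "norm x < 1" "x \<noteq> 0" and q: "q = x ^ 2"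
  shows "(qpoch_inf x x + qpoch_inf (- x) (- x)) / 2
       = qpochs_inf [q, q ^ 7, q ^ 8] (q ^ 8) * qpochs_inf [q ^ 6, q ^ 10] (q ^ 16)"
proof -
  have q1: "norm q < 1" "q \<noteq> 0" using assms norm_power_less_one[of x 2] by auto
  define e where "e n = (x powi n + (- x) powi n) / 2" for n
  have e: "e n = (if even n then q powi (n div 2) else 0)" for n
    unfolding e_def q by (rule even_part_power_int)
  define v where "v x k = (-1) powi k * x powi (3 * (k * (k - 1) div 2) + k)" for x :: complex and k :: int
  have "(v y has_sum (qpoch_inf y y)) UNIV" if "y = x \<or> y = - x" for y
    using pentagonal_number_theorem[of y] assms that by (auto simp: v_def [abs_def])
  hence "((\<lambda>k. (v x k + v (- x) k) * (1 / 2)) has_sum ((qpoch_inf x x + qpoch_inf (- x) (- x)) * (1 / 2))) UNIV"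
    by (intro has_sum_add has_sum_cmult_left) auto
  \<comment> \<open>The parity of a pentagonal number depends on its index modulo 4. Only residues 0
    and 3 give even exponents, with signs plus and minus.\<close>
  hence "((\<lambda>k. \<Sum>r\<in>{0..<4}. (v x (4 * k + r) + v (- x) (4 * k + r)) * (1 / 2)) has_sum
     ((qpoch_inf x x + qpoch_inf (- x) (- x)) / 2)) UNIV"
    by (intro has_sum_int_residues) simp_all
  also have "(\<lambda>k. \<Sum>r\<in>{0..<4}. (v x (4 * k + r) + v (- x) (4 * k + r)) * (1 / 2))
     = (\<lambda>k. q powi (12 * k ^ 2 - k) - q powi (12 * k ^ 2 + 17 * k + 6))"
  proof
    fix k :: int
    have v: "(v x j + v (- x) j) * (1 / 2) = (-1) powi j * e (3 * (j * (j - 1) div 2) + j)" for j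
      by (simp add: v_def e_def field_simps)
    have four: "(\<Sum>r\<in>{0..<4}. h r) = h 0 + h 1 + h 2 + h 3" for h :: "int \<Rightarrow> complex"
    proof -
      have "{0..<4::int} = {0, 1, 2, 3}" by auto
      thus ?thesis by simp
    qed
    have exps: "3 * ((4 * k) * (4 * k - 1) div 2) + 4 * k = 2 * (12 * k ^ 2 - k)"
      "3 * ((4 * k + 1) * (4 * k + 1 - 1) div 2) + (4 * k + 1) = 2 * (12 * k ^ 2 + 5 * k) + 1"
      "3 * ((4 * k + 2) * (4 * k + 2 - 1) div 2) + (4 * k + 2) = 2 * (12 * k ^ 2 + 11 * k + 2) + 1"
      "3 * ((4 * k + 3) * (4 * k + 3 - 1) div 2) + (4 * k + 3) = 2 * (12 * k ^ 2 + 17 * k + 6)"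
      by (simp_all add: power2_eq_square algebra_simps)
    show "(\<Sum>r\<in>{0..<4}. (v x (4 * k + r) + v (- x) (4 * k + r)) * (1 / 2))
        = q powi (12 * k ^ 2 - k) - q powi (12 * k ^ 2 + 17 * k + 6)"
      unfolding four v add_0_right exps by (simp add: e)
  qed
  finally have 1: "((\<lambda>k. q powi (12 * k ^ 2 - k) - q powi (12 * k ^ 2 + 17 * k + 6)) has_sum
     ((qpoch_inf x x + qpoch_inf (- x) (- x)) / 2)) UNIV" .
  \<comment> \<open>The two halves converge separately, so the second can be reflected by itself.
    Under \<open>k\<close> to \<open>-1 - k\<close> it becomes the negative half of the quintuple
    series in base \<open>q ^ 8\<close> at \<open>z = q\<close>.\<close>
  obtain A B where A: "((\<lambda>k. q powi (12 * k ^ 2 - k)) has_sum A) UNIV"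
    and B: "((\<lambda>k. q powi (12 * k ^ 2 + 17 * k + 6)) has_sum B) UNIV"
    using summable_quadratic_power[OF q1, of 12 "-1" 0] summable_quadratic_power[OF q1, of 12 17 6]
    by (auto simp: summable_on_def)
  from B have "((\<lambda>k. q powi (12 * (-1 - k) ^ 2 + 17 * (-1 - k) + 6)) has_sum B) UNIV"
    by (subst has_sum_reflect)
  moreover have "12 * (-1 - k) ^ 2 + 17 * (-1 - k) + 6 = 12 * k ^ 2 + 7 * k + 1" for k :: int
    by (simp add: power2_eq_square algebra_simps)
  ultimately have B': "((\<lambda>k. q powi (12 * k ^ 2 + 7 * k + 1)) has_sum B) UNIV" by (simp only:)
  have "((\<lambda>k. q powi (8 * (k * (3 * k - 1) div 2) + 3 * k) - q powi (8 * (k * (3 * k - 1) div 2) + 3 * k + 1 + 8 * k))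
     has_sum (qpochs_inf [q, q ^ 7, q ^ 8] (q ^ 8) * qpochs_inf [q ^ 10, q ^ 6] (q ^ 16))) UNIV"
    using quintuple_product_power[OF q1, of 1 8] by simp
  moreover have pent: "8 * (k * (3 * k - 1) div 2) = 12 * k ^ 2 - 4 * k" for k :: int
    using arg_cong[OF pentagonal_double[of k], of "\<lambda>n. 4 * n"]
    by (simp only: mult.assoc [symmetric]) (simp add: algebra_simps power2_eq_square)
  have "8 * (k * (3 * k - 1) div 2) + 3 * k = 12 * k ^ 2 - k"
    "8 * (k * (3 * k - 1) div 2) + 3 * k + 1 + 8 * k = 12 * k ^ 2 + 7 * k + 1" for k :: int
    unfolding pent by simp_all
  ultimately have 2: "((\<lambda>k. q powi (12 * k ^ 2 - k) - q powi (12 * k ^ 2 + 7 * k + 1))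
     has_sum (qpochs_inf [q, q ^ 7, q ^ 8] (q ^ 8) * qpochs_inf [q ^ 10, q ^ 6] (q ^ 16))) UNIV"
    by (simp only:)
  have "(qpoch_inf x x + qpoch_inf (- x) (- x)) / 2 = A - B"
    using has_sum_unique[OF 1 has_sum_diff[OF A B]] .
  also have "\<dots> = qpochs_inf [q, q ^ 7, q ^ 8] (q ^ 8) * qpochs_inf [q ^ 10, q ^ 6] (q ^ 16)"
    using has_sum_unique[OF has_sum_diff[OF A B'] 2] .
  finally show ?thesis by (simp add: qpochs_inf_def)
qed

section \<open>The indices of the series\<close>

text \<open>The list holds the residues modulo 120 of the solutions of
  \<open>k ^ 2 mod 240 = 1\<close>, in increasing order, so this enumerates all positive
  solutions.\<close>

definition sq_root :: "nat \<Rightarrow> nat" where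
  "sq_root n = 120 * (n div 8) + [1, 31, 41, 49, 71, 79, 89, 119] ! (n mod 8)"

lemma less_8_cases: "r < 8 \<Longrightarrow> r \<in> {0, 1, 2, 3, 4, 5, 6, 7}" for r :: nat
  by auto

lemma sq_root_block:
  "r < 8 \<Longrightarrow> sq_root (8 * k + r) = 120 * k + [1, 31, 41, 49, 71, 79, 89, 119] ! r"
  by (simp add: sq_root_def)

lemma strict_mono_sq_root: "strict_mono sq_root"
  unfolding strict_mono_Suc_iff
proof
  fix n :: nat
  define k r where "k = n div 8" and "r = n mod 8"
  have n: "n = 8 * k + r" and r: "r < 8" by (auto simp: k_def r_def)
  show "sq_root n < sq_root (Suc n)"
  proof (cases "r = 7")
    case True
    hence "Suc n = 8 * Suc k + 0" using n by simp
    thus ?thesis using sq_root_block[OF r, of k] sq_root_block[of 0 "Suc k"] True n by simp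
  next
    case False
    hence "Suc n = 8 * k + Suc r" "Suc r < 8" using n r by auto
    thus ?thesis using sq_root_block[OF r, of k] sq_root_block[of "Suc r" k] n less_8_cases[OF r] False
      by auto
  qed
qed

text \<open>Modulus 120 suffices because the cross term of \<open>(120 * j + r) ^ 2\<close> is
  \<open>240 * j * r\<close>. The 120 remaining residues are checked by evaluation.\<close>

lemma square_mod_240_iff:
  fixes k :: nat
  shows "k ^ 2 mod 240 = 1 \<longleftrightarrow> k mod 120 \<in> {1, 31, 41, 49, 71, 79, 89, 119}"
proof -
  define r where "r = k mod 120"
  obtain j where "k = 120 * j + r" unfolding r_def by (metis mult_div_mod_eq)
  hence "k ^ 2 = 240 * (60 * j ^ 2 + j * r) + r ^ 2"
    by (simp add: power2_eq_square algebra_simps)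
  hence "k ^ 2 mod 240 = r ^ 2 mod 240" by (simp only: mod_mult_self4)
  moreover have "\<forall>i\<in>set [0..119]. i ^ 2 mod 240 = 1 \<longleftrightarrow> i \<in> {1, 31, 41, 49, 71, 79, 89, 119::int}"
    by code_simp
  hence "int r ^ 2 mod 240 = 1 \<longleftrightarrow> int r \<in> {1, 31, 41, 49, 71, 79, 89, 119}"
    by (rule bspec) (simp add: r_def)
  hence "int (r ^ 2 mod 240) = int 1 \<longleftrightarrow> r \<in> {1, 31, 41, 49, 71, 79, 89, 119}"
    by (simp add: zmod_int)
  hence "r ^ 2 mod 240 = 1 \<longleftrightarrow> r \<in> {1, 31, 41, 49, 71, 79, 89, 119}"
    by (simp only: of_nat_eq_iff)
  ultimately show ?thesis by (simp add: r_def)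
qed

lemma range_sq_root: "range sq_root = {k. k ^ 2 mod 240 = 1}"
proof safe
  fix n
  show "sq_root n ^ 2 mod 240 = 1"
    unfolding square_mod_240_iff sq_root_def using less_8_cases[of "n mod 8"] by auto
next
  fix k :: nat assume "k ^ 2 mod 240 = 1"
  hence k: "k mod 120 \<in> {1, 31, 41, 49, 71, 79, 89, 119}" unfolding square_mod_240_iff .
  obtain r where r: "r < 8" "k mod 120 = [1, 31, 41, 49, 71, 79, 89, 119] ! r"
  proof -
    have "set [1, 31, 41, 49, 71, 79, 89, 119] = {1, 31, 41, 49, 71, 79, 89, 119::nat}" by simp
    with k have "k mod 120 \<in> set [1, 31, 41, 49, 71, 79, 89, 119]" by simp
    then obtain i where "i < length [1, 31, 41, 49, 71, 79, 89, 119::nat]"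
      "[1, 31, 41, 49, 71, 79, 89, 119] ! i = k mod 120" unfolding in_set_conv_nth by blast
    thus ?thesis by (intro that[of i]) simp_all
  qed
  have "k = sq_root (8 * (k div 120) + r)"
    unfolding sq_root_block[OF r(1)] r(2) [symmetric] by simp
  thus "k \<in> range sq_root" by blast
qed

text \<open>Strong induction: if \<open>f\<close> and \<open>g\<close> agree below \<open>n\<close>,
  then \<open>g n\<close> is a value of \<open>f\<close> at some index at least \<open>n\<close>, so
  \<open>f n \<le> g n\<close>, and symmetrically.\<close>

lemma strict_mono_range_unique:
  fixes f g :: "nat \<Rightarrow> nat"
  assumes "strict_mono f" "strict_mono g" "range f = range g"
  shows "f = g"
proof
  have *: "f n \<le> g n" if f: "strict_mono f" and g: "strict_mono g" and fg: "range g \<subseteq> range f"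
    and eq: "\<And>m. m < n \<Longrightarrow> f m = g m"
    for f g :: "nat \<Rightarrow> nat" and n
  proof -
    obtain k where k: "g n = f k" using fg by auto
    have "\<not> k < n" using eq[of k] k strict_mono_eq[OF g] by auto
    thus ?thesis using k strict_mono_less_eq[OF f] by auto
  qed
  fix n
  show "f n = g n"
  proof (induction n rule: less_induct)
    case (less n)
    show ?case using *[of f g n] *[of g f n] less assms by (simp add: order_antisym)
  qed
qed

text \<open>The sequence \<open>s\<close> obtained from \<open>sq_root\<close> is strictly
  increasing with the same range as \<open>sq_seq\<close>, so the two coincide.\<close>

lemma sq_seq_eq: "240 * sq_seq n + 1 = sq_root n ^ 2"
proof -
  define s where "s n = (sq_root n ^ 2 - 1) div 240" for n
  have s: "240 * s n + 1 = sq_root n ^ 2" for n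
  proof -
    have "sq_root n ^ 2 mod 240 = 1" using range_sq_root by blast
    thus ?thesis unfolding s_def by (metis add_diff_cancel_right' mult_div_mod_eq nonzero_mult_div_cancel_left zero_neq_numeral)
  qed
  have "strict_mono s"
  proof (rule strict_monoI)
    fix m n :: nat assume "m < n"
    hence "sq_root m ^ 2 < sq_root n ^ 2"
      by (intro power_strict_mono strict_monoD[OF strict_mono_sq_root]) auto
    thus "s m < s n" using s[of m] s[of n] by linarith
  qed
  moreover have "range s = range sq_seq"
    unfolding range_sq_seq
  proof safe
    fix n
    show "is_square (240 * s n + 1)" unfolding s by simp
  next
    fix m :: nat assume "is_square (240 * m + 1)"
    then obtain k :: nat where k: "240 * m + 1 = k ^ 2" by (auto simp: is_nth_power_def)
    have "k ^ 2 mod 240 = 1" unfolding k [symmetric] by simp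
    then obtain n where "k = sq_root n" using range_sq_root by blast
    hence "m = s n" using s[of n] k by simp
    thus "m \<in> range s" by blast
  qed
  ultimately have "sq_seq = s" using strict_mono_range_unique[OF strict_mono_sq_seq] by metis
  thus ?thesis using s by simp
qed

text \<open>The index of the square root \<open>\<bar>120 * j + c\<bar>\<close>, where \<open>c\<close> is
  entry number \<open>p\<close> of \<open>1, 31, 41, 49\<close>.\<close>

definition root_index :: "nat \<Rightarrow> int \<Rightarrow> nat" where
  "root_index p j = (if j \<ge> 0 then 8 * nat j + p else 8 * nat (- j - 1) + (7 - p))"

lemma inj_root_index:
  assumes "p < 4"
  shows "inj (root_index p)"
proof (rule inj_on_inverseI)
  fix j :: int
  \<comment> \<open>A left inverse: since \<open>p < 4\<close>, the residue is below 4 exactly when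
    \<open>j\<close> is non-negative.\<close>
  define h where "h n = (if n mod 8 < 4 then int (n div 8) else - int (n div 8) - 1)" for n :: nat
  have "p \<in> {0, 1, 2, 3}" using assms by auto
  thus "h (root_index p j) = j" by (auto simp: root_index_def h_def)
qed

lemma range_root_index:
  assumes "p < 4"
  shows "range (root_index p) = {n. n mod 8 = p \<or> n mod 8 = 7 - p}"
proof safe
  fix n assume "p = n mod 8"
  hence "n = root_index p (int (n div 8))" by (simp add: root_index_def)
  thus "n \<in> range (root_index (n mod 8))" using \<open>p = n mod 8\<close> by blast
next
  fix n assume "n mod 8 = 7 - p"
  moreover from this have "n = 8 * (n div 8) + (7 - p)" by (metis mult_div_mod_eq)
  ultimately have "n = root_index p (- int (n div 8) - 1)" by (simp add: root_index_def)
  thus "n \<in> range (root_index p)" by blast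
next
  fix j assume "root_index p j mod 8 \<noteq> 7 - p"
  moreover have "p \<in> {0, 1, 2, 3}" using assms by auto
  ultimately show "root_index p j mod 8 = p" by (auto simp: root_index_def split: if_splits)
qed

text \<open>The residue list is symmetric, entries \<open>p\<close> and \<open>7 - p\<close> adding
  up to 120. For negative \<open>j\<close> the absolute value is therefore
  \<open>120 * (- j - 1)\<close> plus entry \<open>7 - p\<close>.\<close>

lemma sq_root_root_index:
  assumes "p < 4"
  shows "int (sq_root (root_index p j)) = \<bar>120 * j + [1, 31, 41, 49] ! p\<bar>"
proof -
  have "p \<in> {0, 1, 2, 3}" using assms by auto
  thus ?thesis
    using sq_root_block[of p "nat j"] sq_root_block[of "7 - p" "nat (- j - 1)"]
    by (auto simp: root_index_def)
qed

lemma sq_seq_root_index: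
  assumes "p < 4"
  shows "int (sq_seq (root_index p j)) = 60 * j ^ 2 + [1, 31, 41, 49] ! p * j + [0, 4, 7, 10] ! p"
proof -
  have p: "p \<in> {0, 1, 2, 3}" using assms by auto
  have "240 * int (sq_seq (root_index p j)) + 1 = int (sq_root (root_index p j)) ^ 2"
    using arg_cong[OF sq_seq_eq[of "root_index p j"], of int] by simp
  also have "\<dots> = (120 * j + [1, 31, 41, 49] ! p) ^ 2"
    unfolding sq_root_root_index[OF assms] by simp
  finally show ?thesis using p by (auto simp: power2_eq_square algebra_simps)
qed

text \<open>Adding 8 to the index raises the exponent by 2, so the sign depends on the residue
  modulo 8: minus for 2, 3, 4, 5 and plus for 0, 1, 6, 7. Hence \<open>p\<close> and
  \<open>7 - p\<close> share a sign.\<close>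

lemma sign_root_index:
  assumes "p < 4"
  shows "(-1) ^ ((root_index p j + 2) div 4) = (if p < 2 then 1 else - 1 :: complex)"
proof -
  have p: "p \<in> {0, 1, 2, 3}" using assms by auto
  have sgn: "(-1) ^ ((8 * m + r + 2) div 4) = ((-1) ^ ((r + 2) div 4) :: complex)" for m r :: nat
  proof -
    have "(8 * m + r + 2) div 4 = 2 * m + (r + 2) div 4" by presburger
    thus ?thesis by (simp add: power_add power_mult)
  qed
  show ?thesis
  proof (cases "j \<ge> 0")
    case True
    show ?thesis unfolding root_index_def if_P[OF True] sgn using p by auto
  next
    case False
    show ?thesis unfolding root_index_def if_not_P[OF False] sgn using p by auto
  qed
qed

lemma sq_seq_series:
  fixes q :: complex
  assumes "norm q < 1" "q \<noteq> 0"
    and R: "((\<lambda>k. q powi (60 * k ^ 2 - k) + q powi (60 * k ^ 2 + 31 * k + 4)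
             - q powi (60 * k ^ 2 + 79 * k + 26) - q powi (60 * k ^ 2 + 71 * k + 21)) has_sum R) UNIV"
  shows "(\<lambda>n. (-1) ^ ((n + 2) div 4) * q ^ sq_seq n) sums R"
proof -
  define f where "f n = (-1) ^ ((n + 2) div 4) * q ^ sq_seq n" for n
  have f: "f (root_index p j) = (if p < 2 then 1 else - 1)
      * q powi (60 * j ^ 2 + [1, 31, 41, 49] ! p * j + [0, 4, 7, 10] ! p)" if "p < 4" for p j
    unfolding f_def sign_root_index[OF that] sq_seq_root_index[OF that, symmetric] by simp
  have ex: "\<exists>S. ((\<lambda>k. q powi (60 * k ^ 2 + b * k + c)) has_sum S) UNIV" for b c
    using summable_quadratic_power[OF assms(1,2), of 60 b c] by (simp add: summable_on_def)
  have reflect: "((\<lambda>k. q powi (60 * k ^ 2 + b' * k + c')) has_sum S) UNIV"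
    if "((\<lambda>k. q powi (60 * k ^ 2 + b * k + c)) has_sum S) UNIV"
      "\<And>k. 60 * (d - k) ^ 2 + b * (d - k) + c = 60 * k ^ 2 + b' * k + c'" for b c b' c' d :: int and S
    using that(1) has_sum_reflect[of "\<lambda>k. q powi (60 * k ^ 2 + b * k + c)" d S] unfolding that(2) by simp
  \<comment> \<open>One bilateral series for each \<open>c\<close> in 1, 31, 41, 49. Reflection
    carries \<open>c = 1\<close> to \<open>- 1\<close> by \<open>k\<close> to \<open>- k\<close>,
    and 41 and 49 to 79 and 71 by \<open>k\<close> to \<open>-1 - k\<close>, which matches the four
    series in \<open>R\<close>.\<close>
  obtain S0 S1 S2 S3 where S:
    "((\<lambda>k. q powi (60 * k ^ 2 + 1 * k + 0)) has_sum S0) UNIV"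
    "((\<lambda>k. q powi (60 * k ^ 2 + 31 * k + 4)) has_sum S1) UNIV"
    "((\<lambda>k. q powi (60 * k ^ 2 + 41 * k + 7)) has_sum S2) UNIV"
    "((\<lambda>k. q powi (60 * k ^ 2 + 49 * k + 10)) has_sum S3) UNIV"
    using ex by meson
  have "((\<lambda>k. q powi (60 * k ^ 2 + (- 1) * k + 0)) has_sum S0) UNIV"
    by (rule reflect[OF S(1), of 0]) (simp add: power2_eq_square algebra_simps)
  moreover have "((\<lambda>k. q powi (60 * k ^ 2 + 79 * k + 26)) has_sum S2) UNIV"
    by (rule reflect[OF S(3), of "-1"]) (simp add: power2_eq_square algebra_simps)
  moreover have "((\<lambda>k. q powi (60 * k ^ 2 + 71 * k + 21)) has_sum S3) UNIV"
    by (rule reflect[OF S(4), of "-1"]) (simp add: power2_eq_square algebra_simps)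
  ultimately have "((\<lambda>k. q powi (60 * k ^ 2 + (- 1) * k + 0) + q powi (60 * k ^ 2 + 31 * k + 4)
             - q powi (60 * k ^ 2 + 79 * k + 26) - q powi (60 * k ^ 2 + 71 * k + 21)) has_sum (S0 + S1 - S2 - S3)) UNIV"
    by (intro has_sum_diff has_sum_add S(2))
  hence R_eq: "R = S0 + S1 - S2 - S3"
    using has_sum_unique[OF R] by simp
  \<comment> \<open>\<open>root_index p\<close> carries the bilateral series onto the indices
    congruent to \<open>p\<close> or \<open>7 - p\<close> modulo 8; the four classes partition the
    naturals.\<close>
  have block: "(f has_sum (if p < 2 then S else - S)) {n. n mod 8 = p \<or> n mod 8 = 7 - p}"
    if "p < 4" "((\<lambda>k. q powi (60 * k ^ 2 + [1, 31, 41, 49] ! p * k + [0, 4, 7, 10] ! p)) has_sum S) UNIV" for p S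
  proof -
    have "((\<lambda>j. f (root_index p j)) has_sum (if p < 2 then 1 else - 1) * S) UNIV"
      unfolding f[OF that(1)] by (intro has_sum_cmult_right that(2))
    thus ?thesis
      unfolding range_root_index[OF that(1), symmetric] has_sum_reindex[OF inj_root_index[OF that(1)]]
      by (simp add: o_def split: if_splits)
  qed
  have blocks: "(f has_sum S0) {n. n mod 8 = 0 \<or> n mod 8 = 7}" "(f has_sum S1) {n. n mod 8 = 1 \<or> n mod 8 = 6}"
    "(f has_sum (- S2)) {n. n mod 8 = 2 \<or> n mod 8 = 5}" "(f has_sum (- S3)) {n. n mod 8 = 3 \<or> n mod 8 = 4}"
    using block[of 0 S0] block[of 1 S1] block[of 2 S2] block[of 3 S3] S by simp_all
  have "(f has_sum (S0 + S1 + - S2 + - S3)) ({n. n mod 8 = 0 \<or> n mod 8 = 7} \<union> {n. n mod 8 = 1 \<or> n mod 8 = 6}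
      \<union> {n. n mod 8 = 2 \<or> n mod 8 = 5} \<union> {n. n mod 8 = 3 \<or> n mod 8 = 4})"
    by (intro has_sum_Un_disjoint blocks) auto
  also have "{n. n mod 8 = 0 \<or> n mod 8 = 7} \<union> {n. n mod 8 = 1 \<or> n mod 8 = 6}
      \<union> {n. n mod 8 = 2 \<or> n mod 8 = 5} \<union> {n. n mod 8 = 3 \<or> n mod 8 = 4} = (UNIV :: nat set)"
  proof (intro equalityI subset_UNIV subsetI)
    fix n :: nat
    have "n mod 8 \<in> {0, 1, 2, 3, 4, 5, 6, 7}" by (rule less_8_cases) simp
    thus "n \<in> {n. n mod 8 = 0 \<or> n mod 8 = 7} \<union> {n. n mod 8 = 1 \<or> n mod 8 = 6}
      \<union> {n. n mod 8 = 2 \<or> n mod 8 = 5} \<union> {n. n mod 8 = 3 \<or> n mod 8 = 4}" by auto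
  qed
  finally show ?thesis
    unfolding R_eq f_def using has_sum_imp_sums by fastforce
qed

theorem theorem7:
  fixes q :: complex
  assumes "norm q < 1"
  shows "(\<lambda>n. (-1) ^ ((n + 2) div 4) * q ^ sq_seq n) sums
           (qpochs_inf [q, q ^ 7, q ^ 8] (q ^ 8) * qpochs_inf [q ^ 6, q ^ 10] (q ^ 16)
             / qpochs_inf [q, q ^ 4] (q ^ 5))"
proof (cases "q = 0")
  case True
  have "sq_root 0 = 1" by (simp add: sq_root_def)
  hence "sq_seq 0 = 0" using sq_seq_eq[of 0] by simp
  hence "sq_seq n = 0 \<longleftrightarrow> n = 0" for n
    using strict_mono_eq[OF strict_mono_sq_seq, of n 0] by simp
  hence "(\<lambda>n. (-1) ^ ((n + 2) div 4) * q ^ sq_seq n) = (\<lambda>n. if n = 0 then 1 else 0)"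
    using True by (auto simp: fun_eq_iff power_0_left)
  moreover have "(\<lambda>n::nat. if n = 0 then 1 else 0 :: complex) sums 1"
    using sums_single[of 0 "\<lambda>_. 1 :: complex"] by simp
  ultimately show ?thesis using True by (simp add: qpochs_inf_def qpoch_inf_def)
next
  case False
  \<comment> \<open>Either square root would serve: only \<open>q = x ^ 2\<close> and the resulting
    bounds on \<open>x\<close> are used.\<close>
  define x where "x = csqrt q"
  have q: "q = x ^ 2" by (simp add: x_def)
  have x: "norm x < 1" "x \<noteq> 0"
    using assms False by (auto simp: q norm_power power_less_one_iff)
  show ?thesis
    using sq_seq_series[OF assms False euler_even_part_quotient_series[OF x q]]
    unfolding euler_even_part[OF x q] .
qed

end
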